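(* Consider the single-source M/G/1 queue with an unreliable server described in the context, with arrival rate $\lambda_1>0$, in steady state, with $\lambda_1\beta^{(1,1)}(1+\alpha\gamma^{(1,1)})<1$. Then the Laplace-Stieltjes transform $W^*(a)$, $a>0$, of the stationary sojourn time (time from arrival to departure) of a packet is $$W^*(a)=\frac{a\,S^*\bigl(a+\alpha(1-R^*(a))\bigr)\,p_0}{a-\lambda_1\Bigl(1-S^*\bigl(a+\alpha(1-R^*(a))\bigr)\Bigr)},\qquad p_0=1-\lambda_1\beta^{(1,1)}\bigl(1+\alpha\gamma^{(1,1)}\bigr).$$
   Context: Model: packets arrive according to a Poisson process of rate $\lambda_1>0$ at a single server with an infinite first-come-first-served queue. Service times (amounts of processing required) are i.i.d. nonnegative random variables with Laplace-Stieltjes transform $S^*(s)=\int_0^\infty e^{-st}\,dF_S(t)$ and finite mean $\beta^{(1,1)}$. While (and only while) it is serving a packet, the server fails after an exponentially distributed lifetime of mean $1/\alpha$ (failures occur at rate $\alpha$ during active processing). On failure a repair starts immediately; repair times are i.i.d. with Laplace-Stieltjes transform $R^*(s)=\int_0^\infty e^{-st}\,dF_R(t)$ and finite mean $\gamma^{(1,1)}$. After the repair, the interrupted packet resumes its remaining service. Arrivals, service times, lifetimes and repair times are mutually independent. *)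

theory Defs
  imports "HOL-Probability.Probability"
begin

text \<open>The M/G/1 queue with a server that breaks down while it is processing. Packet 0 arrives at
  time 0, and packets are numbered in the order of arrival. Packet \<open>n\<close> brings the gap to the next
  arrival, its service requirement, and, for each \<open>k\<close>, the amount of processing time that elapses
  between the start (\<open>k = 0\<close>) or the \<open>k\<close>-th resumption of its service and the next server failure,
  together with the duration of the repair that follows that failure. A failure that would only
  come after the requirement of the packet has been met does not happen.\<close>

datatype source = Gap nat | Service nat | Lifetime nat nat | Repair nat nat

definition mean :: "real measure \<Rightarrow> real" where
  "mean F = (\<integral>t. t \<partial>F)"

definition LST :: "real measure \<Rightarrow> real \<Rightarrow> real" where
  "LST F s = (\<integral>t. exp (- s * t) \<partial>F)"

locale unreliable_MG1 = prob_space M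
  for M :: "'w measure"
    and lam \<alpha> :: real
    and F\<^sub>S F\<^sub>R :: "real measure"
    and X :: "source \<Rightarrow> 'w \<Rightarrow> real" +
  assumes arrival_rate_pos: "lam > 0"
    and failure_rate_pos: "\<alpha> > 0"
    and service_distribution: "real_distribution F\<^sub>S"
    and service_nonneg: "AE t in F\<^sub>S. 0 \<le> t"
    and service_finite_mean: "integrable F\<^sub>S (\<lambda>t. t)"
    and repair_distribution: "real_distribution F\<^sub>R"
    and repair_nonneg: "AE t in F\<^sub>R. 0 \<le> t"
    and repair_finite_mean: "integrable F\<^sub>R (\<lambda>t. t)"
    and independent: "indep_vars (\<lambda>_. borel) X UNIV"
    and gap_law: "\<And>n. distributed M lborel (X (Gap n)) (exponential_density lam)"
    and service_law: "\<And>n. distr M borel (X (Service n)) = F\<^sub>S"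
    and lifetime_law: "\<And>n k. distributed M lborel (X (Lifetime n k)) (exponential_density \<alpha>)"
    and repair_law: "\<And>n k. distr M borel (X (Repair n k)) = F\<^sub>R"

definition arrival :: "(source \<Rightarrow> 'w \<Rightarrow> real) \<Rightarrow> nat \<Rightarrow> 'w \<Rightarrow> real" where
  "arrival X n \<omega> = (\<Sum>i<n. X (Gap i) \<omega>)"

text \<open>Indices of the failures that interrupt packet \<open>n\<close>: failure \<open>k\<close> strikes when the packet has
  received processing \<open>\<Sum>j\<le>k. X (Lifetime n j) \<omega>\<close>, provided that its requirement exceeds this. The
  set is almost surely finite.\<close>

definition failures :: "(source \<Rightarrow> 'w \<Rightarrow> real) \<Rightarrow> nat \<Rightarrow> 'w \<Rightarrow> nat set" where
  "failures X n \<omega> = {k. (\<Sum>j\<le>k. X (Lifetime n j) \<omega>) < X (Service n) \<omega>}"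

text \<open>Time from the start of the service of packet \<open>n\<close> to its departure.\<close>

definition occupation :: "(source \<Rightarrow> 'w \<Rightarrow> real) \<Rightarrow> nat \<Rightarrow> 'w \<Rightarrow> real" where
  "occupation X n \<omega> = X (Service n) \<omega> + (\<Sum>k\<in>failures X n \<omega>. X (Repair n k) \<omega>)"

text \<open>First-come-first-served departure times; \<open>v\<close> is the time at which the server will have
  cleared (repairs included) all packets found in the system by packet 0.\<close>

primrec departure :: "(source \<Rightarrow> 'w \<Rightarrow> real) \<Rightarrow> real \<Rightarrow> nat \<Rightarrow> 'w \<Rightarrow> real" where
  "departure X v 0 \<omega> = max (arrival X 0 \<omega>) v + occupation X 0 \<omega>"
| "departure X v (Suc n) \<omega> =
     max (arrival X (Suc n) \<omega>) (departure X v n \<omega>) + occupation X (Suc n) \<omega>"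

definition sojourn :: "(source \<Rightarrow> 'w \<Rightarrow> real) \<Rightarrow> real \<Rightarrow> nat \<Rightarrow> 'w \<Rightarrow> real" where
  "sojourn X v n \<omega> = departure X v n \<omega> - arrival X n \<omega>"

text \<open>The law of the sojourn time of packet \<open>n\<close> when the initial backlog has law \<open>\<pi>\<close> and is
  independent of all later randomness.\<close>

definition sojourn_law ::
    "'w measure \<Rightarrow> (source \<Rightarrow> 'w \<Rightarrow> real) \<Rightarrow> real measure \<Rightarrow> nat \<Rightarrow> real measure" where
  "sojourn_law M X \<pi> n = distr (\<pi> \<Otimes>\<^sub>M M) borel (\<lambda>(v, \<omega>). sojourn X v n \<omega>)"

text \<open>Stationarity is meant along the sequence of packets. The sojourn times form a
  time-homogeneous Markov chain, so it suffices to ask that their law does not depend on \<open>n\<close>.\<close>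

definition steady_state ::
    "'w measure \<Rightarrow> (source \<Rightarrow> 'w \<Rightarrow> real) \<Rightarrow> real measure \<Rightarrow> bool" where
  "steady_state M X \<pi> \<longleftrightarrow>
     real_distribution \<pi> \<and> (AE v in \<pi>. 0 \<le> v) \<and>
     (\<forall>n. sojourn_law M X \<pi> n = sojourn_law M X \<pi> 0)"

end

theory Submission
  imports Defs
begin

text \<open>The occupation times \<open>C\<^sub>n\<close> are i.i.d. Given a service requirement \<open>x\<close>, the number of failures is
  Poisson with mean \<open>\<alpha> x\<close>, so \<open>C\<close> has transform \<open>S\<^sup>*(s + \<alpha> (1 - R\<^sup>*(s)))\<close> and mean
  \<open>\<beta> (1 + \<alpha> \<gamma>)\<close>. Sojourn times satisfy Lindley's recursion
  \<open>W\<^sub>n\<^sub>+\<^sub>1 = max 0 (W\<^sub>n - G\<^sub>n) + C\<^sub>n\<^sub>+\<^sub>1\<close> with exponential gaps \<open>G\<^sub>n\<close>; integrating the gap out gives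
  \<open>(s - \<lambda>) W\<^sup>*(s) = C\<^sup>*(s) (s W\<^sup>*(\<lambda>) - \<lambda> W\<^sup>*(s))\<close> for a stationary \<open>W\<close>, and letting \<open>s\<close> tend
  to 0 identifies \<open>W\<^sup>*(\<lambda>) = p\<^sub>0\<close>. Conversely, a geometric sum of equilibrium occupation times, as in
  the Pollaczek--Khinchine formula, is a backlog whose transform solves this equation on the
  imaginary axis, so it is stationary by uniqueness of characteristic functions.\<close>

section \<open>Laplace transforms of laws on the half-line\<close>

text \<open>The fixed-point equation is linear in the transform of the stationary law and involves
  one unknown constant, the transform at \<open>lam\<close>. This is the probability that the
  exponential gap outlasts the sojourn, so that the next packet finds an idle server. At s = 0 the
  equation only says 0 = 0; divided by s it has a nontrivial limit, where the normalisation of a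
  probability law fixes the constant.

  Uniqueness of laws is used on the imaginary axis, so transforms take complex arguments in the
  closed right half-plane. Identities are kept multiplied out, so that s = 0 and s =
  \<open>lam\<close> need no separate treatment; the one division by s - \<open>lam\<close> takes
  place on the imaginary axis, where it is harmless.

  The delicate object is the occupation time, a sum over a random set that might be infinite, in
  which case the sum defaults to 0. The number of terms is determined by requirement and lifetimes,
  hence independent of the repairs. Splitting by this number leads to differences of Erlang
  distribution functions, which are Poisson weights.\<close>

locale nonneg_distribution = real_distribution F for F :: "real measure" +
  assumes AE_nonneg: "AE t in F. 0 \<le> t"

text \<open>The complex extension of \<open>LST\<close>: real arguments give the formula of the
  theorem, imaginary ones give characteristic functions.\<close>

definition laplace :: "real measure \<Rightarrow> complex \<Rightarrow> complex" where
  "laplace F s = (\<integral>t. exp (- s * of_real t) \<partial>F)"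

lemma norm_exp_le_1: "norm (exp (- s * complex_of_real t)) \<le> 1" if "0 \<le> Re s" "0 \<le> t"
  using that by (simp add: norm_exp_eq_Re)

text \<open>A difference quotient of the exponential at 0, taken along a sequence because dominated
  convergence and Fatou's lemma will be applied to it.\<close>

lemma exp_slope_tendsto:
  fixes t :: real
  assumes "u \<longlonglongrightarrow> 0" and pos: "\<And>n. 0 < u n"
  shows "(\<lambda>n. (1 - exp (- u n * t)) / u n) \<longlonglongrightarrow> t"
proof -
  have "((\<lambda>x. - exp (- x * t)) has_field_derivative t) (at 0)"
    by (auto intro!: derivative_eq_intros)
  then have "((\<lambda>x. (1 - exp (- x * t)) / x) \<longlongrightarrow> t) (at 0)"
    unfolding has_field_derivative_iff by simp
  moreover have "filterlim u (at 0) sequentially"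
    unfolding filterlim_at using assms by (simp add: less_imp_neq[THEN not_sym])
  ultimately show ?thesis by (rule filterlim_compose)
qed

context nonneg_distribution
begin

lemma prob_UNIV [simp]: "prob UNIV = 1"
  using prob_space by simp

lemma integrable_laplace [simp]: "integrable F (\<lambda>t. exp (- s * complex_of_real t))" if "0 \<le> Re s"
proof (rule integrable_const_bound[where B=1])
  show "AE t in F. norm (exp (- s * complex_of_real t)) \<le> 1"
    using AE_nonneg by eventually_elim (rule norm_exp_le_1[OF that])
qed measurable

lemma norm_laplace_le_1: "norm (laplace F s) \<le> 1" if "0 \<le> Re s"
proof -
  have "norm (laplace F s) \<le> (\<integral>t. norm (exp (- s * complex_of_real t)) \<partial>F)"
    unfolding laplace_def by (rule integral_norm_bound)
  also have "\<dots> \<le> (\<integral>t. 1 \<partial>F)"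
  proof (rule integral_mono_AE)
    show "AE t in F. norm (exp (- s * complex_of_real t)) \<le> 1"
      using AE_nonneg by eventually_elim (rule norm_exp_le_1[OF that])
  qed (use integrable_norm[OF integrable_laplace[OF that]] in auto)
  finally show ?thesis by simp
qed

lemma integrable_LST [simp]: "integrable F (\<lambda>t. exp (- a * t))" if "0 \<le> a"
proof (rule integrable_const_bound[where B=1])
  show "AE t in F. norm (exp (- a * t)) \<le> 1"
    using AE_nonneg by eventually_elim (use that in auto)
qed measurable

lemma integrable_LST' [simp]: "integrable F (\<lambda>t. exp (- (a * t)))" if "0 \<le> a"
  using integrable_LST[OF that] by simp

lemma LST_le_1: "LST F a \<le> 1" if "0 \<le> a"
proof -
  have "LST F a \<le> (\<integral>t. 1 \<partial>F)" unfolding LST_def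
    by (rule integral_mono_AE) (use that AE_nonneg in auto)
  then show ?thesis by simp
qed

lemma LST_tendsto_1:
  assumes "u \<longlonglongrightarrow> 0" and "\<And>n. 0 \<le> u n"
  shows "(\<lambda>n. LST F (u n)) \<longlonglongrightarrow> 1"
proof -
  have "(\<lambda>n. \<integral>t. exp (- u n * t) \<partial>F) \<longlonglongrightarrow> (\<integral>t. 1 \<partial>F)"
  proof (rule integral_dominated_convergence[where w="\<lambda>_. 1"])
    have "(\<lambda>n. exp (- u n * t)) \<longlonglongrightarrow> exp (- 0 * t)" for t
      by (intro tendsto_intros assms)
    then show "AE t in F. (\<lambda>n. exp (- u n * t)) \<longlonglongrightarrow> 1" by simp
    show "AE t in F. norm (exp (- u n * t)) \<le> 1" for n
      using AE_nonneg by eventually_elim (use assms in auto)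
  qed auto
  then show ?thesis by (simp add: LST_def)
qed

lemma one_minus_LST: "1 - LST F a = (\<integral>t. 1 - exp (- a * t) \<partial>F)" if "0 \<le> a"
  using that by (simp add: LST_def)

lemma one_minus_LST_le: "1 - LST F a \<le> a * mean F"
  if "0 \<le> a" and int: "integrable F (\<lambda>t. t)"
proof -
  have "1 - LST F a \<le> (\<integral>t. a * t \<partial>F)"
    unfolding one_minus_LST[OF that(1)]
  proof (rule integral_mono)
    show "1 - exp (- a * t) \<le> a * t" for t
      using exp_ge_add_one_self[of "- a * t"] by simp
  qed (use that in auto)
  then show ?thesis by (simp add: mean_def)
qed

text \<open>Since 1 - exp(-x) \<le> x, the quotients are dominated by the identity, which is
  integrable. Means enter the proof only as such slopes at 0.\<close>

lemma LST_slope_tendsto_mean: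
  assumes int: "integrable F (\<lambda>t. t)" and "u \<longlonglongrightarrow> 0" and pos: "\<And>n. 0 < u n"
  shows "(\<lambda>n. (1 - LST F (u n)) / u n) \<longlonglongrightarrow> mean F"
proof -
  have "(\<lambda>n. \<integral>t. (1 - exp (- u n * t)) / u n \<partial>F) \<longlonglongrightarrow> (\<integral>t. t \<partial>F)"
  proof (rule integral_dominated_convergence[where w="\<lambda>t. t"])
    have "(\<lambda>n. (1 - exp (- u n * t)) / u n) \<longlonglongrightarrow> t" for t
      by (rule exp_slope_tendsto[OF assms(2) pos])
    then show "AE t in F. (\<lambda>n. (1 - exp (- u n * t)) / u n) \<longlonglongrightarrow> t" by (rule AE_I2)
    show "AE t in F. norm ((1 - exp (- u n * t)) / u n) \<le> t" for n
      using AE_nonneg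
    proof eventually_elim
      case (elim t)
      have "1 - exp (- u n * t) \<le> u n * t"
        using exp_ge_add_one_self[of "- u n * t"] by simp
      moreover have "0 \<le> 1 - exp (- u n * t)" using pos[of n] elim by simp
      ultimately show ?case
        using pos[of n] by (simp only: real_norm_def abs_of_nonneg abs_divide abs_of_pos pos_divide_le_eq mult.commute)
    qed
    show "(\<lambda>t. t) \<in> borel_measurable F" by measurable
    show "(\<lambda>t. (1 - exp (- u n * t)) / u n) \<in> borel_measurable F" for n by measurable
  qed (rule int)
  moreover have "(\<integral>t. (1 - exp (- u n * t)) / u n \<partial>F) = (1 - LST F (u n)) / u n" for n
    unfolding integral_divide_zero by (subst one_minus_LST) (use pos[of n] in \<open>auto intro: less_imp_le\<close>)
  ultimately show ?thesis unfolding mean_def by (simp only:)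
qed

end

lemma laplace_of_real: "laplace F (of_real a) = of_real (LST F a)"
proof -
  have "laplace F (of_real a) = (\<integral>t. of_real (exp (- a * t)) \<partial>F)"
    unfolding laplace_def by (intro Bochner_Integration.integral_cong) (auto simp flip: exp_of_real)
  then show ?thesis by (simp add: LST_def)
qed

text \<open>On the imaginary axis \<open>laplace\<close> is the characteristic function at the
  reflected argument, so Levy's theorem applies.\<close>

lemma laplace_unique:
  assumes "real_distribution F" "real_distribution G"
    and eq: "\<And>t::real. laplace F (\<i> * t) = laplace G (\<i> * t)"
  shows "F = G"
proof (rule Levy_uniqueness[OF assms(1,2)], rule ext)
  fix t
  have "char H t = laplace H (\<i> * of_real (- t))" for H
    by (simp add: char_def laplace_def mult_ac)
  then show "char F t = char G t" using eq[of "- t"] by simp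
qed

section \<open>One step of the Lindley recursion\<close>

lemma exp_uminus_mult_add: "exp (- s * complex_of_real (x + y)) = exp (- s * x) * exp (- s * y)"
  by (subst exp_add[symmetric]) (simp add: distrib_left)

lemma laplace_convolution:
  assumes "nonneg_distribution F" "nonneg_distribution G" "0 \<le> Re s"
  shows "laplace (F \<star> G) s = laplace F s * laplace G s"
proof -
  interpret F: nonneg_distribution F by fact
  interpret G: nonneg_distribution G by fact
  interpret FG: pair_prob_space F G ..
  have AE: "AE z in F \<Otimes>\<^sub>M G. norm (exp (- s * complex_of_real (fst z + snd z))) \<le> 1"
  proof (rule FG.AE_pair_measure)
    show "AE x in F. AE y in G. norm (exp (- s * complex_of_real (fst (x, y) + snd (x, y)))) \<le> 1"
      using F.AE_nonneg
    proof eventually_elim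
      case (elim x)
      show ?case using G.AE_nonneg
        by eventually_elim (use elim assms in \<open>auto intro!: norm_exp_le_1 simp flip: of_real_add\<close>)
    qed
  qed measurable
  have int: "integrable (F \<Otimes>\<^sub>M G) (\<lambda>(x, y). exp (- s * complex_of_real (x + y)))"
    by (rule FG.integrable_const_bound[where B=1]) (use AE in \<open>auto simp: case_prod_beta\<close>)
  have "laplace (F \<star> G) s = (\<integral>(x, y). exp (- s * complex_of_real (x + y)) \<partial>(F \<Otimes>\<^sub>M G))"
    unfolding laplace_def convolution_def
    by (subst integral_distr) (auto intro!: Bochner_Integration.integral_cong)
  also have "\<dots> = (\<integral>x. \<integral>y. exp (- s * complex_of_real x) * exp (- s * complex_of_real y) \<partial>G \<partial>F)"
    by (subst FG.integral_fst[symmetric, OF int]) (simp only: exp_uminus_mult_add)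
  also have "\<dots> = laplace F s * laplace G s"
    using assms by (simp add: laplace_def)
  finally show ?thesis .
qed

lemma nonneg_distribution_convolution:
  assumes "nonneg_distribution F" "nonneg_distribution G"
  shows "nonneg_distribution (F \<star> G)"
proof -
  interpret F: nonneg_distribution F by fact
  interpret G: nonneg_distribution G by fact
  interpret FG: pair_prob_space F G ..
  interpret C: real_distribution "F \<star> G"
    unfolding convolution_def by (rule FG.real_distribution_distr) measurable
  have "AE z in F \<Otimes>\<^sub>M G. 0 \<le> fst z + snd z"
  proof (rule FG.AE_pair_measure)
    show "AE x in F. AE y in G. 0 \<le> fst (x, y) + snd (x, y)"
      using F.AE_nonneg
    proof eventually_elim
      case (elim x)
      show ?case using G.AE_nonneg by eventually_elim (use elim in auto)
    qed
  qed measurable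
  then have "AE t in F \<star> G. 0 \<le> t"
    unfolding convolution_def by (subst AE_distr_iff) (auto simp: case_prod_beta)
  then show ?thesis by unfold_locales
qed

text \<open>If a packet has sojourn law \<open>\<mu>\<close>, this is the law of the wait of its
  successor. One Lindley step therefore sends \<open>\<mu>\<close> to
  \<open>waiting lam \<mu> \<star> F\<close>, with \<open>F\<close> the law of an occupation
  time.\<close>

definition waiting :: "real \<Rightarrow> real measure \<Rightarrow> real measure" where
  "waiting lam \<mu> =
    distr (\<mu> \<Otimes>\<^sub>M density lborel (exponential_density lam)) borel (\<lambda>(w, g). max 0 (w - g))"

lemma nonneg_distribution_waiting:
  assumes "real_distribution \<mu>" "0 < lam"
  shows "nonneg_distribution (waiting lam \<mu>)"
proof -
  interpret \<mu>: real_distribution \<mu> by fact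
  interpret E: prob_space "density lborel (exponential_density lam)"
    using \<open>0 < lam\<close> by (rule prob_space_exponential_density)
  interpret P: pair_prob_space \<mu> "density lborel (exponential_density lam)" ..
  interpret C: real_distribution "waiting lam \<mu>"
    unfolding waiting_def by (rule P.real_distribution_distr) measurable
  have "AE t in waiting lam \<mu>. 0 \<le> t"
    unfolding waiting_def by (subst AE_distr_iff) (auto simp: case_prod_beta)
  then show ?thesis by unfold_locales
qed

text \<open>The expectation over the gap for a fixed sojourn time \<open>w\<close>. The factor s -
  \<open>lam\<close> on the left provides an antiderivative without any division, so s =
  \<open>lam\<close> is covered too.\<close>

lemma laplace_waiting_point:
  assumes "0 < lam" "0 \<le> Re s" "0 \<le> w"
  shows "(s - lam) * (\<integral>g. exp (- s * complex_of_real (max 0 (w - g))) \<partial>density lborel (exponential_density lam))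
    = s * exp (- complex_of_real lam * w) - lam * exp (- s * w)" (is "_ * (\<integral>g. ?e g \<partial>?E) = _")
proof -
  interpret E: prob_space ?E
    using \<open>0 < lam\<close> by (rule prob_space_exponential_density)
  \<comment> \<open>Once 1 is subtracted, the integrand vanishes for gaps beyond \<open>w\<close>,
    where the wait is 0. What remains is the integral of \<open>f\<close> over a compact interval,
    and \<open>\<Phi>\<close> is an antiderivative of \<open>f\<close>.\<close>
  define f where "f g = (s - lam) * (lam * exp (- complex_of_real lam * g) * (exp (- s * of_real (w - g)) - 1))" for g
  define \<Phi> where "\<Phi> g = lam * exp (- s * w) * exp ((s - lam) * complex_of_real g) + (s - lam) * exp (- complex_of_real lam * g)" for g
  have int: "integrable ?E ?e"
    by (rule E.integrable_const_bound[where B=1])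
       (use assms in \<open>auto intro!: AE_I2 simp: norm_exp_eq_Re max_def mult_nonneg_nonneg\<close>)
  have "(s - lam) * ((\<integral>g. ?e g \<partial>?E) - 1) = (\<integral>g. (s - lam) * (?e g - 1) \<partial>?E)"
    using int E.prob_space by simp
  also have "\<dots> = (\<integral>g. exponential_density lam g *\<^sub>R ((s - lam) * (?e g - 1)) \<partial>lborel)"
    by (subst integral_density) (use assms in auto)
  also have "\<dots> = (\<integral>g. indicator {0..w} g *\<^sub>R f g \<partial>lborel)"
    by (intro Bochner_Integration.integral_cong)
       (auto simp: f_def exponential_density_def indicator_def max_def mult_ac scaleR_conv_of_real simp flip: exp_of_real)
  also have "\<dots> = \<Phi> w - \<Phi> 0"
  proof (rule integral_FTC_atLeastAtMost[OF \<open>0 \<le> w\<close>])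
    show "continuous_on {0..w} f" unfolding f_def by (intro continuous_intros)
    show "(\<Phi> has_vector_derivative f x) (at x within {0..w})" for x
    proof -
      have "((\<lambda>z. lam * exp (- s * w) * exp ((s - lam) * z) + (s - lam) * exp (- complex_of_real lam * z))
        has_field_derivative (lam * exp (- s * w) * (exp ((s - lam) * of_real x) * (s - lam))
          + (s - lam) * (exp (- complex_of_real lam * of_real x) * (- lam)))) (at (of_real x))"
        by (auto intro!: derivative_eq_intros)
      moreover have "(lam * exp (- s * w) * (exp ((s - lam) * of_real x) * (s - lam))
          + (s - lam) * (exp (- complex_of_real lam * of_real x) * (- lam))) = f x"
      proof -
        have *: "exp ((s - lam) * of_real x) = exp (s * of_real x) * exp (- complex_of_real lam * of_real x)"
          and **: "exp (- s * of_real (w - x)) = exp (- s * w) * exp (s * of_real x)"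
          by (subst exp_add[symmetric], simp add: left_diff_distrib right_diff_distrib)+
        show ?thesis
          unfolding f_def * ** by (simp add: ring_distribs mult_ac)
      qed
      ultimately show ?thesis unfolding \<Phi>_def
        by (auto intro!: has_vector_derivative_real_field)
    qed
  qed
  finally have *: "(s - lam) * ((\<integral>g. ?e g \<partial>?E) - 1) = \<Phi> w - \<Phi> 0" .
  have "(s - lam) * (\<integral>g. ?e g \<partial>?E) = \<Phi> w - \<Phi> 0 + (s - lam)"
    unfolding *[symmetric] by (simp add: algebra_simps)
  also have "\<dots> = s * exp (- complex_of_real lam * w) - lam * exp (- s * w)"
  proof -
    have "exp (- s * w) * exp ((s - lam) * of_real w) = exp (- complex_of_real lam * w)"
      by (subst exp_add[symmetric]) (simp add: left_diff_distrib)
    then show ?thesis unfolding \<Phi>_def mult.assoc by (simp add: left_diff_distrib)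
  qed
  finally show ?thesis .
qed

text \<open>By Fubini this is the average of \<open>laplace_waiting_point\<close> over
  \<open>w\<close>. The constant \<open>laplace \<mu> lam\<close> collects the probabilities
  exp(-\<open>lam\<close> w) that the gap outlasts the sojourn.\<close>

lemma laplace_waiting:
  assumes "nonneg_distribution \<mu>" "0 < lam" "0 \<le> Re s"
  shows "(s - lam) * laplace (waiting lam \<mu>) s = s * laplace \<mu> lam - lam * laplace \<mu> s"
proof -
  let ?E = "density lborel (exponential_density lam)"
  let ?e = "\<lambda>w g. exp (- s * complex_of_real (max 0 (w - g)))"
  interpret \<mu>: nonneg_distribution \<mu> by fact
  interpret E: prob_space ?E
    using \<open>0 < lam\<close> by (rule prob_space_exponential_density)
  interpret P: pair_prob_space \<mu> ?E ..
  have int: "integrable (\<mu> \<Otimes>\<^sub>M ?E) (\<lambda>(w, g). ?e w g)"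
    by (rule P.integrable_const_bound[where B=1])
       (use assms in \<open>auto intro!: AE_I2 simp: norm_exp_eq_Re max_def mult_nonneg_nonneg\<close>)
  have "laplace (waiting lam \<mu>) s = (\<integral>(w, g). ?e w g \<partial>(\<mu> \<Otimes>\<^sub>M ?E))"
    unfolding laplace_def waiting_def
    by (subst integral_distr) (auto intro!: Bochner_Integration.integral_cong)
  also have "\<dots> = (\<integral>w. \<integral>g. ?e w g \<partial>?E \<partial>\<mu>)"
    by (rule P.integral_fst[symmetric, OF int])
  finally have "(s - lam) * laplace (waiting lam \<mu>) s = (\<integral>w. (s - lam) * (\<integral>g. ?e w g \<partial>?E) \<partial>\<mu>)"
    by simp
  also have "\<dots> = (\<integral>w. s * exp (- complex_of_real lam * w) - lam * exp (- s * w) \<partial>\<mu>)"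
  proof (rule integral_cong_AE)
    show "AE w in \<mu>. (s - lam) * (\<integral>g. ?e w g \<partial>?E) = s * exp (- complex_of_real lam * w) - lam * exp (- s * w)"
      using \<mu>.AE_nonneg by eventually_elim (rule laplace_waiting_point[OF assms(2,3)])
  qed measurable
  also have "\<dots> = s * laplace \<mu> lam - lam * laplace \<mu> s"
    using \<mu>.integrable_laplace[of lam] \<mu>.integrable_laplace[of s] assms
    unfolding laplace_def by (subst Bochner_Integration.integral_diff) auto
  finally show ?thesis .
qed

section \<open>Fixed points of the Lindley recursion\<close>

text \<open>The denominator of the final formula is positive, because 1 - \<open>LST F a\<close> is
  at most \<open>a * mean F\<close>.\<close>

lemma ergodic_gain_pos: "0 < a - lam * (1 - LST F a)"
  if "nonneg_distribution F" "integrable F (\<lambda>t. t)" "0 < lam" "lam * mean F < 1" "0 < a"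
proof -
  interpret nonneg_distribution F by fact
  have "lam * (1 - LST F a) \<le> lam * (a * mean F)"
    using one_minus_LST_le[of a] that by (intro mult_left_mono) auto
  also have "\<dots> < a"
    using mult_strict_left_mono[OF \<open>lam * mean F < 1\<close> \<open>0 < a\<close>] by (simp add: mult_ac)
  finally show ?thesis by simp
qed

lemma LST_lindley_fixed_point:
  assumes "nonneg_distribution \<mu>" "nonneg_distribution F" "integrable F (\<lambda>t. t)"
    and "0 < lam" "lam * mean F < 1" and fixed: "(waiting lam \<mu> \<star> F) = \<mu>" and "0 < a"
  shows "LST \<mu> a = a * LST F a * (1 - lam * mean F) / (a - lam * (1 - LST F a))"
proof -
  interpret \<mu>: nonneg_distribution \<mu> by fact
  interpret F: nonneg_distribution F by fact
  have W: "nonneg_distribution (waiting lam \<mu>)"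
    by (rule nonneg_distribution_waiting[OF \<mu>.real_distribution_axioms \<open>0 < lam\<close>])
  have eq: "(x - lam * (1 - LST F x)) * LST \<mu> x = x * LST \<mu> lam * LST F x" if "0 < x" for x
  proof -
    have "(of_real x - of_real lam) * laplace \<mu> (of_real x)
      = (of_real x * laplace \<mu> lam - lam * laplace \<mu> (of_real x)) * laplace F (of_real x)"
      using laplace_waiting[OF \<open>nonneg_distribution \<mu>\<close> \<open>0 < lam\<close>, of "of_real x"]
        laplace_convolution[OF W \<open>nonneg_distribution F\<close>, of "of_real x"] fixed that
      by (simp flip: mult.assoc)
    then have "complex_of_real ((x - lam) * LST \<mu> x) = of_real ((x * LST \<mu> lam - lam * LST \<mu> x) * LST F x)"
      by (simp add: laplace_of_real)
    then have "(x - lam) * LST \<mu> x = (x * LST \<mu> lam - lam * LST \<mu> x) * LST F x"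
      unfolding of_real_eq_iff .
    then show ?thesis by (simp add: algebra_simps)
  qed
  define u where "u n = 1 / real (Suc n)" for n
  have u: "u \<longlonglongrightarrow> 0" "\<And>n. 0 < u n" "\<And>n. 0 \<le> u n"
    unfolding u_def by (rule LIMSEQ_Suc[OF lim_1_over_n]) auto
  \<comment> \<open>This is \<open>eq\<close> divided by \<open>u n\<close>. Both sides now have
    informative limits, and all that is asked of \<open>\<mu>\<close> is that its transform tends to
    1.\<close>
  have "(1 - lam * ((1 - LST F (u n)) / u n)) * LST \<mu> (u n) = LST \<mu> lam * LST F (u n)" for n
    using eq[OF u(2)[of n]] u(2)[of n] by (simp add: field_simps)
  moreover have "(\<lambda>n. (1 - lam * ((1 - LST F (u n)) / u n)) * LST \<mu> (u n)) \<longlonglongrightarrow> (1 - lam * mean F) * 1"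
    by (intro tendsto_intros F.LST_slope_tendsto_mean \<mu>.LST_tendsto_1 u assms)
  moreover have "(\<lambda>n. LST \<mu> lam * LST F (u n)) \<longlonglongrightarrow> LST \<mu> lam * 1"
    by (intro tendsto_intros F.LST_tendsto_1 u)
  ultimately have "LST \<mu> lam = 1 - lam * mean F"
    by (simp add: LIMSEQ_unique)
  with eq[OF \<open>0 < a\<close>] have "(a - lam * (1 - LST F a)) * LST \<mu> a = a * LST F a * (1 - lam * mean F)"
    by (simp add: mult_ac)
  then show ?thesis
    using ergodic_gain_pos[OF assms(2-5,7)] by (simp add: eq_divide_eq mult.commute)
qed

section \<open>Construction of a stationary backlog: equilibrium law and geometric sums\<close>

text \<open>The transform of a uniform fraction of \<open>x\<close>, multiplied by s x so that it
  also holds when this product is 0. It turns a size-biased value into the equilibrium law.\<close>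

lemma integral_exp_segment:
  "s * complex_of_real x * (\<integral>u. exp (- s * complex_of_real (x * u)) \<partial>density lborel (indicator {0..1}))
    = 1 - exp (- s * x)"
proof -
  define f where "f u = s * x * exp (- s * complex_of_real (x * u))" for u :: real
  define \<Phi> where "\<Phi> u = - exp (- s * x * complex_of_real u)" for u :: real
  have "s * complex_of_real x * (\<integral>u. exp (- s * complex_of_real (x * u)) \<partial>density lborel (indicator {0..1}))
    = (\<integral>u. f u \<partial>density lborel (\<lambda>u. ennreal (indicator {0..1} u)))"
    unfolding f_def ennreal_indicator by simp
  also have "\<dots> = (\<integral>u. indicator {0..1} u *\<^sub>R f u \<partial>lborel)"
    by (rule integral_density) (auto simp: f_def)
  also have "\<dots> = \<Phi> 1 - \<Phi> 0"
  proof (rule integral_FTC_atLeastAtMost)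
    show "continuous_on {0..1} f" unfolding f_def by (intro continuous_intros)
    show "(\<Phi> has_vector_derivative f u) (at u within {0..1})" for u
    proof -
      have "((\<lambda>z. - exp (- s * x * z)) has_field_derivative f u) (at (of_real u))"
        unfolding f_def by (rule derivative_eq_intros refl)+ (simp add: mult.assoc)
      then show ?thesis unfolding \<Phi>_def by (rule has_vector_derivative_real_field)
    qed
  qed simp
  finally show ?thesis by (simp add: \<Phi>_def)
qed

text \<open>The equilibrium (stationary excess) law is realised as a uniform fraction of a size-biased
  value, which avoids introducing the tail function of \<open>F\<close>.\<close>

lemma exists_equilibrium_distribution:
  assumes "nonneg_distribution F" and int: "integrable F (\<lambda>t. t)"
  shows "\<exists>\<nu>. nonneg_distribution \<nu> \<and> (\<forall>s::complex. 0 \<le> Re s \<longrightarrow> mean F * s * laplace \<nu> s = 1 - laplace F s)"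
proof -
  interpret nonneg_distribution F by fact
  have mean_nonneg: "0 \<le> mean F"
    unfolding mean_def by (rule integral_nonneg_AE[OF AE_nonneg])
  show ?thesis
  proof (cases "mean F = 0")
    \<comment> \<open>Here \<open>F\<close> is concentrated at 0 and both sides of the equation
      vanish, whatever \<open>\<nu>\<close> is; \<open>F\<close> itself serves as witness.\<close>
    case True
    then have "AE t in F. t = 0"
      using AE_nonneg int unfolding mean_def by (subst (asm) integral_nonneg_eq_0_iff_AE) auto
    then have "AE t in F. exp (- s * complex_of_real t) = 1" for s :: complex
      by eventually_elim simp
    then have "laplace F s = (\<integral>t. 1 \<partial>F)" for s :: complex
      unfolding laplace_def by (intro integral_cong_AE) auto
    then show ?thesis
      using True \<open>nonneg_distribution F\<close> by (intro exI[of _ F]) simp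
  next
    case False
    define b where "b = mean F"
    have b: "0 < b" using False mean_nonneg by (simp add: b_def)
    \<comment> \<open>\<open>B\<close> is the size-biased law and \<open>U\<close> the uniform law
      on the unit interval. In the transform the density x / b supplies the factor x that
      \<open>integral_exp_segment\<close> asks for, and b cancels against the mean.\<close>
    define B where "B = density F (\<lambda>x. ennreal (x / b))"
    define U where "U = density lborel (indicator {0..1::real} :: real \<Rightarrow> ennreal)"
    have AE_b: "AE x in F. 0 \<le> x / b" using AE_nonneg by eventually_elim (use b in auto)
    interpret B: prob_space B
    proof
      have "emeasure B (space B) = (\<integral>\<^sup>+x. ennreal (x / b) \<partial>F)"
        unfolding B_def by (subst emeasure_density) (auto intro!: nn_integral_cong)
      also have "\<dots> = ennreal (\<integral>x. x / b \<partial>F)"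
        by (rule nn_integral_eq_integral) (use int AE_b in auto)
      also have "\<dots> = 1" using b int by (simp add: b_def mean_def)
      finally show "emeasure B (space B) = 1" .
    qed
    interpret U: prob_space U
      by standard (simp add: U_def emeasure_density)
    interpret BU: pair_prob_space B U ..
    have [measurable_cong]: "sets B = sets borel" "sets U = sets borel"
      by (simp_all add: B_def U_def)
    have AE_B: "AE x in B. 0 \<le> x"
      unfolding B_def using AE_nonneg by (subst AE_density) auto
    have AE_U: "AE u in U. 0 \<le> u"
      unfolding U_def by (subst AE_density) (auto split: split_indicator)
    have AE: "AE z in B \<Otimes>\<^sub>M U. 0 \<le> fst z * snd z"
    proof (rule BU.AE_pair_measure)
      show "AE x in B. AE u in U. 0 \<le> fst (x, u) * snd (x, u)"
        using AE_B
      proof eventually_elim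
        case (elim x)
        show ?case using AE_U by eventually_elim (use elim in auto)
      qed
    qed measurable
    define \<nu> where "\<nu> = distr (B \<Otimes>\<^sub>M U) borel (\<lambda>z. fst z * snd z)"
    interpret \<nu>: real_distribution \<nu>
      unfolding \<nu>_def by (rule BU.real_distribution_distr) measurable
    have "AE t in \<nu>. 0 \<le> t" unfolding \<nu>_def using AE by (subst AE_distr_iff) auto
    then have "nonneg_distribution \<nu>" by unfold_locales
    moreover have "mean F * s * laplace \<nu> s = 1 - laplace F s" if "0 \<le> Re s" for s :: complex
    proof -
      have int2: "integrable (B \<Otimes>\<^sub>M U) (\<lambda>z. exp (- s * complex_of_real (fst z * snd z)))"
      proof (rule BU.integrable_const_bound[where B=1])
        show "AE z in B \<Otimes>\<^sub>M U. norm (exp (- s * complex_of_real (fst z * snd z))) \<le> 1"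
          using AE by eventually_elim (rule norm_exp_le_1[OF that])
      qed measurable
      have "laplace \<nu> s = (\<integral>z. exp (- s * complex_of_real (fst z * snd z)) \<partial>(B \<Otimes>\<^sub>M U))"
        unfolding laplace_def \<nu>_def by (subst integral_distr) auto
      also have "\<dots> = (\<integral>x. \<integral>u. exp (- s * complex_of_real (x * u)) \<partial>U \<partial>B)"
        unfolding BU.integral_fst'[symmetric, OF int2] by (simp only: fst_conv snd_conv)
      also have "\<dots> = (\<integral>x. (x / b) *\<^sub>R (\<integral>u. exp (- s * complex_of_real (x * u)) \<partial>U) \<partial>F)"
        unfolding B_def by (rule integral_density[OF _ _ AE_b]) measurable
      finally have "b * s * laplace \<nu> s
        = (\<integral>x. b * s * ((x / b) *\<^sub>R (\<integral>u. exp (- s * complex_of_real (x * u)) \<partial>U)) \<partial>F)"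
        by (simp only: integral_mult_right_zero)
      also have "\<dots> = (\<integral>x. 1 - exp (- s * complex_of_real x) \<partial>F)"
      proof (rule Bochner_Integration.integral_cong[OF refl])
        fix x
        have "b * s * ((x / b) *\<^sub>R (\<integral>u. exp (- s * complex_of_real (x * u)) \<partial>U))
          = s * complex_of_real x * (\<integral>u. exp (- s * complex_of_real (x * u)) \<partial>U)"
          using b by (simp add: scaleR_conv_of_real)
        then show "b * s * ((x / b) *\<^sub>R (\<integral>u. exp (- s * complex_of_real (x * u)) \<partial>U))
          = 1 - exp (- s * complex_of_real x)"
          unfolding U_def integral_exp_segment .
      qed
      also have "\<dots> = 1 - laplace F s"
        unfolding laplace_def
        by (subst Bochner_Integration.integral_diff) (use integrable_laplace[OF that] in simp_all)
      finally show ?thesis by (simp add: b_def)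
    qed
    ultimately show ?thesis by blast
  qed
qed

text \<open>\<open>\<pi>\<close> is the law of a geometric number of independent summands with law
  \<open>\<nu>\<close>; conditioning on that number turns its transform into a geometric series with
  ratio \<open>\<rho> * laplace \<nu> s\<close>, of modulus below 1.\<close>

lemma exists_geometric_compound:
  fixes \<rho> :: real
  assumes "nonneg_distribution \<nu>" "0 \<le> \<rho>" "\<rho> < 1"
  shows "\<exists>\<pi>. nonneg_distribution \<pi> \<and> (\<forall>s::complex. 0 \<le> Re s \<longrightarrow> laplace \<pi> s * (1 - \<rho> * laplace \<nu> s) = 1 - \<rho>)"
proof -
  interpret \<nu>: nonneg_distribution \<nu> by fact
  \<comment> \<open>With this parameter the weight of n is (1 - \<rho>) \<rho>^n, starting at n = 0;
    the empty sum accounts for an idle server.\<close>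
  define N where "N = measure_pmf (geometric_pmf (1 - \<rho>))"
  define P where "P = PiM UNIV (\<lambda>_::nat. \<nu>)"
  define sm where "sm = (\<lambda>(n::nat, y). \<Sum>i<n. y i :: real)"
  interpret PP: product_prob_space "\<lambda>_::nat. \<nu>" UNIV ..
  interpret N: prob_space N unfolding N_def by (rule prob_space_measure_pmf)
  interpret P: prob_space P unfolding P_def by (rule prob_space_PiM) (rule \<nu>.prob_space_axioms)
  interpret NP: pair_prob_space N P ..
  have sN[measurable_cong]: "sets N = sets (count_space UNIV)" by (simp add: N_def)
  have [measurable]: "(\<lambda>y. y i) \<in> borel_measurable P" for i
    unfolding P_def by measurable
  have [measurable]: "sm \<in> borel_measurable (N \<Otimes>\<^sub>M P)"
  proof -
    have "sm \<in> borel_measurable (count_space UNIV \<Otimes>\<^sub>M P)"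
      by (rule measurable_pair_measure_countable1) (auto simp: sm_def)
    then show ?thesis
      by (subst measurable_cong_sets[OF sets_pair_measure_cong[OF sN refl] refl])
  qed
  have "AE y in P. 0 \<le> y i" for i
    unfolding P_def by (rule AE_PiM_component) (auto simp: \<nu>.AE_nonneg \<nu>.prob_space_axioms)
  then have AE_P: "AE y in P. \<forall>i. 0 \<le> y i" by (simp add: AE_all_countable)
  have AE: "AE z in N \<Otimes>\<^sub>M P. 0 \<le> sm z"
  proof (rule NP.AE_pair_measure)
    show "AE n in N. AE y in P. 0 \<le> sm (n, y)"
      by (rule AE_I2, use AE_P in eventually_elim) (auto simp: sm_def intro!: sum_nonneg)
  qed measurable
  define \<pi> where "\<pi> = distr (N \<Otimes>\<^sub>M P) borel sm"
  interpret \<pi>: real_distribution \<pi>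
    unfolding \<pi>_def by (rule NP.real_distribution_distr) measurable
  have "AE t in \<pi>. 0 \<le> t" unfolding \<pi>_def using AE by (subst AE_distr_iff) auto
  then have "nonneg_distribution \<pi>" by unfold_locales
  moreover have "laplace \<pi> s * (1 - \<rho> * laplace \<nu> s) = 1 - \<rho>" if "0 \<le> Re s" for s :: complex
  proof -
    let ?L = "laplace \<nu> s"
    have L: "norm (\<rho> * ?L) < 1"
      using \<nu>.norm_laplace_le_1[OF that] assms mult_left_le[of "norm ?L" \<rho>]
      by (simp add: norm_mult)
    have int: "integrable (N \<Otimes>\<^sub>M P) (\<lambda>z. exp (- s * complex_of_real (sm z)))"
    proof (rule NP.integrable_const_bound[where B=1])
      show "AE z in N \<Otimes>\<^sub>M P. norm (exp (- s * complex_of_real (sm z))) \<le> 1"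
        using AE by eventually_elim (rule norm_exp_le_1[OF that])
    qed measurable
    have inner: "(\<integral>y. exp (- s * complex_of_real (sm (n, y))) \<partial>P) = ?L ^ n" for n
    proof -
      have meas: "(\<lambda>y. \<Prod>i<n. exp (- s * complex_of_real (y i))) \<in> borel_measurable (PiM {..<n} (\<lambda>_. \<nu>))"
      proof (rule borel_measurable_prod)
        fix i assume "i \<in> {..<n}"
        then have [measurable]: "(\<lambda>y. y i) \<in> borel_measurable (PiM {..<n} (\<lambda>_. \<nu>))"
          using measurable_component_singleton[of i "{..<n}" "\<lambda>_. \<nu>"]
          by (simp cong: measurable_cong_sets)
        show "(\<lambda>y. exp (- s * complex_of_real (y i))) \<in> borel_measurable (PiM {..<n} (\<lambda>_. \<nu>))"
          by measurable
      qed
      \<comment> \<open>The product formula for integrals concerns finite index sets, so the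
        infinite product is first projected to its first \<open>n\<close> coordinates.\<close>
      have "(\<integral>y. exp (- s * complex_of_real (sm (n, y))) \<partial>P)
        = (\<integral>y. (\<Prod>i<n. exp (- s * complex_of_real (restrict y {..<n} i))) \<partial>P)"
        by (simp add: sm_def exp_sum sum_distrib_left flip: sum_negf)
      also have "\<dots> = (\<integral>y. (\<Prod>i<n. exp (- s * complex_of_real (y i))) \<partial>distr P (PiM {..<n} (\<lambda>_. \<nu>)) (\<lambda>y. restrict y {..<n}))"
        unfolding P_def by (subst integral_distr[OF _ meas]) (auto intro!: measurable_restrict_subset)
      also have "\<dots> = (\<integral>y. (\<Prod>i<n. exp (- s * complex_of_real (y i))) \<partial>PiM {..<n} (\<lambda>_. \<nu>))"
        unfolding P_def by (subst PP.distr_PiM_restrict_finite) auto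
      also have "\<dots> = ?L ^ n"
        by (subst PP.product_integral_prod) (use \<nu>.integrable_laplace[OF that] in \<open>simp_all add: laplace_def\<close>)
      finally show ?thesis .
    qed
    have "laplace \<pi> s = (\<integral>z. exp (- s * complex_of_real (sm z)) \<partial>(N \<Otimes>\<^sub>M P))"
      unfolding laplace_def \<pi>_def by (subst integral_distr) auto
    also have "\<dots> = (\<integral>n. ?L ^ n \<partial>N)"
      by (simp only: NP.integral_fst'[symmetric, OF int] inner)
    also have "\<dots> = (\<integral>n. (\<rho> ^ n * (1 - \<rho>)) *\<^sub>R ?L ^ n \<partial>count_space UNIV)"
      unfolding N_def measure_pmf_eq_density
      by (subst integral_density) (use assms in \<open>auto\<close>)
    also have "\<dots> = (\<integral>n. (1 - \<rho>) * (\<rho> * ?L) ^ n \<partial>count_space UNIV)"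
      by (simp add: scaleR_conv_of_real power_mult_distrib mult_ac)
    also have "\<dots> = (\<Sum>n. (1 - \<rho>) * (\<rho> * ?L) ^ n)"
    proof (rule integral_count_space_nat)
      show "integrable (count_space UNIV) (\<lambda>n. (1 - \<rho>) * (\<rho> * ?L) ^ n)"
        using L by (auto simp: integrable_count_space_nat_iff norm_mult norm_power intro!: summable_mult summable_geometric)
    qed
    also have "\<dots> = (1 - \<rho>) / (1 - \<rho> * ?L)"
      using L by (simp add: suminf_mult summable_geometric suminf_geometric)
    finally have "laplace \<pi> s = (1 - \<rho>) / (1 - \<rho> * ?L)" .
    moreover have "1 - \<rho> * ?L \<noteq> 0" using L by (metis less_irrefl norm_one right_minus_eq)
    ultimately show ?thesis by simp
  qed
  ultimately show ?thesis by blast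
qed

text \<open>\<open>\<pi>\<close> plays the role of the waiting time and
  \<open>\<pi> \<star> F\<close> that of the sojourn time. The computation amounts to
  \<open>waiting lam (\<pi> \<star> F)\<close> having the same transform as \<open>\<pi>\<close> on
  the imaginary axis.\<close>

lemma exists_lindley_fixed_point:
  assumes "nonneg_distribution F" "integrable F (\<lambda>t. t)" "0 < lam" "lam * mean F < 1"
  shows "\<exists>\<pi>. nonneg_distribution \<pi> \<and> (waiting lam (\<pi> \<star> F) \<star> F) = (\<pi> \<star> F)"
proof -
  interpret F: nonneg_distribution F by fact
  obtain \<nu> where \<nu>: "nonneg_distribution \<nu>"
    and \<nu>_eq: "\<And>s::complex. 0 \<le> Re s \<Longrightarrow> mean F * s * laplace \<nu> s = 1 - laplace F s"
    using exists_equilibrium_distribution[OF assms(1,2)] by blast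
  define \<rho> where "\<rho> = lam * mean F"
  have "0 \<le> mean F" unfolding mean_def by (rule integral_nonneg_AE[OF F.AE_nonneg])
  then have "0 \<le> \<rho>" "\<rho> < 1" using assms by (simp_all add: \<rho>_def)
  then obtain \<pi> where \<pi>: "nonneg_distribution \<pi>"
    and \<pi>_eq: "\<And>s::complex. 0 \<le> Re s \<Longrightarrow> laplace \<pi> s * (1 - \<rho> * laplace \<nu> s) = 1 - \<rho>"
    using exists_geometric_compound[OF \<nu>] by blast
  \<comment> \<open>The Pollaczek-Khinchine formula for the waiting time, without
    denominators.\<close>
  have PK: "laplace \<pi> s * (s - lam * (1 - laplace F s)) = (1 - \<rho>) * s" if "0 \<le> Re s" for s :: complex
  proof -
    have "s - lam * (1 - laplace F s) = s * (1 - \<rho> * laplace \<nu> s)"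
      unfolding \<nu>_eq[OF that, symmetric] by (simp add: \<rho>_def right_diff_distrib mult_ac)
    then show ?thesis using \<pi>_eq[OF that] by (simp add: mult_ac)
  qed
  define \<mu> where "\<mu> = (\<pi> \<star> F)"
  have \<mu>: "nonneg_distribution \<mu>"
    unfolding \<mu>_def by (rule nonneg_distribution_convolution) fact+
  then interpret \<mu>: nonneg_distribution \<mu> .
  have W: "nonneg_distribution (waiting lam \<mu>)"
    by (rule nonneg_distribution_waiting[OF \<mu>.real_distribution_axioms \<open>0 < lam\<close>])
  have WF: "nonneg_distribution (waiting lam \<mu> \<star> F)"
    by (rule nonneg_distribution_convolution) fact+
  have \<mu>_eq: "laplace \<mu> s = laplace \<pi> s * laplace F s" if "0 \<le> Re s" for s :: complex
    unfolding \<mu>_def by (rule laplace_convolution[OF \<pi> assms(1) that])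
  \<comment> \<open>At s = \<open>lam\<close> the second factor in \<open>PK\<close> collapses to
    \<open>lam * laplace F lam\<close>, which leaves \<open>lam\<close> times the transform of
    \<open>\<mu>\<close> on the left.\<close>
  have \<mu>_lam: "laplace \<mu> lam = 1 - \<rho>"
  proof -
    have "lam * (laplace \<pi> lam * laplace F lam) = lam * (1 - \<rho>)"
      using PK[of lam] \<open>0 < lam\<close> by (simp add: algebra_simps)
    then show ?thesis using \<mu>_eq[of lam] \<open>0 < lam\<close> by simp
  qed
  have "(waiting lam \<mu> \<star> F) = \<mu>"
  proof (rule laplace_unique)
    show "real_distribution (waiting lam \<mu> \<star> F)"
      using WF by (rule nonneg_distribution.axioms)
    fix t :: real
    define s where "s = \<i> * complex_of_real t"
    \<comment> \<open>A purely imaginary s differs from the positive real \<open>lam\<close>, so the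
      factor s - \<open>lam\<close> can be cancelled at the end.\<close>
    have s: "0 \<le> Re s" "s \<noteq> lam" using \<open>0 < lam\<close> by (auto simp: s_def complex_eq_iff)
    have "(s - lam) * laplace (waiting lam \<mu> \<star> F) s
      = (s * (1 - \<rho>) - lam * (laplace \<pi> s * laplace F s)) * laplace F s"
      using laplace_waiting[OF \<mu> \<open>0 < lam\<close> s(1)] laplace_convolution[OF W assms(1) s(1)] \<mu>_lam \<mu>_eq[OF s(1)]
      by (simp flip: mult.assoc)
    \<comment> \<open>\<open>PK\<close> replaces s (1 - \<rho>) by \<open>laplace \<pi> s\<close>
      times s - \<open>lam\<close> + \<open>lam * laplace F s\<close>, after which the bracket
      reduces to (s - \<open>lam\<close>) times \<open>laplace \<pi> s\<close>.\<close>
    also have "\<dots> = (s - lam) * laplace \<mu> s"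
      using PK[OF s(1)] unfolding \<mu>_eq[OF s(1)] by algebra
    finally show "laplace (waiting lam \<mu> \<star> F) s = laplace \<mu> s"
      using s(2) by simp
  qed unfold_locales
  with \<pi> show ?thesis unfolding \<mu>_def by blast
qed

section \<open>Auxiliary facts: finite means, Erlang distributions, measurability, independent
  blocks\<close>

text \<open>Fatou's lemma applied to the slopes at 0, a converse of \<open>one_minus_LST_le\<close>.
  It serves for the occupation law, whose finite mean has to be proved before
  \<open>LST_slope_tendsto_mean\<close> can be used.\<close>

lemma (in nonneg_distribution) integrable_of_LST_slope_bound:
  assumes bound: "\<And>a. 0 < a \<Longrightarrow> 1 - LST F a \<le> a * b"
  shows "integrable F (\<lambda>t. t)"
proof -
  define u where "u n = 1 / real (Suc n)" for n
  have u: "u \<longlonglongrightarrow> 0" "\<And>n. 0 < u n"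
    unfolding u_def by (rule LIMSEQ_Suc[OF lim_1_over_n]) auto
  have "(\<integral>\<^sup>+t. ennreal t \<partial>F) \<le> (\<integral>\<^sup>+t. liminf (\<lambda>n. ennreal ((1 - exp (- u n * t)) / u n)) \<partial>F)"
  proof (rule nn_integral_mono)
    fix t
    have "(\<lambda>n. ennreal ((1 - exp (- u n * t)) / u n)) \<longlonglongrightarrow> ennreal t"
      by (intro tendsto_ennrealI exp_slope_tendsto u)
    then show "ennreal t \<le> liminf (\<lambda>n. ennreal ((1 - exp (- u n * t)) / u n))"
      by (simp add: lim_imp_Liminf)
  qed
  also have "\<dots> \<le> liminf (\<lambda>n. \<integral>\<^sup>+t. ennreal ((1 - exp (- u n * t)) / u n) \<partial>F)"
    by (rule nn_integral_liminf) measurable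
  also have "\<dots> \<le> liminf (\<lambda>n::nat. ennreal b)"
  proof (rule Liminf_mono, rule always_eventually, rule allI)
    fix n
    have un: "0 < u n" "0 \<le> u n" using u(2)[of n] by auto
    have "(\<integral>\<^sup>+t. ennreal ((1 - exp (- u n * t)) / u n) \<partial>F) = ennreal (\<integral>t. (1 - exp (- u n * t)) / u n \<partial>F)"
    proof (rule nn_integral_eq_integral)
      show "integrable F (\<lambda>t. (1 - exp (- u n * t)) / u n)"
        using integrable_LST[OF un(2)] by (intro integrable_divide_zero Bochner_Integration.integrable_diff) auto
      show "AE t in F. 0 \<le> (1 - exp (- u n * t)) / u n"
        using AE_nonneg by eventually_elim (use un in auto)
    qed
    also have "(\<integral>t. (1 - exp (- u n * t)) / u n \<partial>F) = (1 - LST F (u n)) / u n"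
      unfolding integral_divide_zero one_minus_LST[OF un(2)] ..
    also have "ennreal \<dots> \<le> ennreal b"
      using bound[OF un(1)] un by (intro ennreal_leI) (simp add: pos_divide_le_eq mult.commute)
    finally show "(\<integral>\<^sup>+t. ennreal ((1 - exp (- u n * t)) / u n) \<partial>F) \<le> ennreal b" .
  qed
  also have "\<dots> < \<infinity>" by (simp add: Liminf_const)
  finally have fin: "(\<integral>\<^sup>+t. ennreal t \<partial>F) < \<infinity>" .
  show ?thesis
  proof (rule integrableI_nonneg)
    show "AE t in F. 0 \<le> t" by (rule AE_nonneg)
    show "(\<integral>\<^sup>+t. ennreal t \<partial>F) < \<infinity>" by (rule fin)
  qed measurable
qed

text \<open>The Poisson weights in the definition of \<open>erlang_CDF\<close> exhaust total mass 1.
  In the queue: failure k is unlikely to strike within processing time x when k is large.\<close>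

lemma erlang_CDF_tendsto_0:
  assumes "0 \<le> x"
  shows "(\<lambda>k. erlang_CDF k l x) \<longlonglongrightarrow> 0"
proof -
  have "(\<lambda>n. (l * x) ^ n / fact n) sums exp (l * x)"
    using exp_converges[of "l * x"] by (simp add: divide_inverse mult.commute)
  then have "(\<lambda>k. 1 - exp (- l * x) * (\<Sum>n\<le>k. (l * x) ^ n / fact n)) \<longlonglongrightarrow> 1 - exp (- l * x) * exp (l * x)"
    unfolding sums_def_le by (intro tendsto_intros)
  also have "1 - exp (- l * x) * exp (l * x) = 0"
    by (simp flip: exp_add)
  also have "(\<lambda>k. 1 - exp (- l * x) * (\<Sum>n\<le>k. (l * x) ^ n / fact n)) = (\<lambda>k. erlang_CDF k l x)"
    using assms by (simp add: erlang_CDF_def sum_distrib_left mult.commute)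
  finally show ?thesis .
qed

lemma erlang_CDF_le_1: "erlang_CDF k l x \<le> 1" if "0 < l"
proof (cases "x < 0")
  case False
  then have "0 \<le> (\<Sum>n\<le>k. (l * x) ^ n * exp (- l * x) / fact n)"
    using that by (intro sum_nonneg) simp
  then show ?thesis using False by (simp add: erlang_CDF_def)
qed (simp add: erlang_CDF_def)

lemma borel_measurable_erlang_CDF [measurable]: "erlang_CDF k l \<in> borel_measurable borel"
  unfolding erlang_CDF_def[abs_def] by measurable

lemma down_closed_nat_cases:
  fixes A :: "nat set"
  assumes "\<And>i j. j \<in> A \<Longrightarrow> i \<le> j \<Longrightarrow> i \<in> A"
  shows "A = UNIV \<or> (\<exists>N. A = {..<N})"
proof (cases "A = UNIV")
  case False
  define N where "N = (LEAST i. i \<notin> A)"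
  have "\<exists>i. i \<notin> A" using False by blast
  then have "N \<notin> A" unfolding N_def by (rule LeastI_ex)
  moreover have "i \<in> A" if "i < N" for i
    using not_less_Least[of i "\<lambda>i. i \<notin> A"] that by (auto simp: N_def)
  ultimately have "A = {..<N}"
    using assms by (metis lessThan_iff linorder_not_le subsetI subset_antisym)
  then show ?thesis by blast
qed simp

text \<open>The sum ranges over a random set and is 0 when that set is infinite. Finiteness is a
  countable condition, and on it the sum becomes a series, which is measurable. \<open>X\<close> and
  \<open>M\<close> are arbitrary because the lemma is also applied to coordinate functions on a
  product space.\<close>

lemma borel_measurable_occupation:
  assumes [measurable]: "X (Service n) \<in> borel_measurable M"
    "\<And>k. X (Lifetime n k) \<in> borel_measurable M" "\<And>k. X (Repair n k) \<in> borel_measurable M"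
  shows "occupation X n \<in> borel_measurable M"
proof -
  have "occupation X n = (\<lambda>\<omega>. X (Service n) \<omega> +
      (if \<exists>m. \<forall>k. (\<Sum>j\<le>k. X (Lifetime n j) \<omega>) < X (Service n) \<omega> \<longrightarrow> k < m
       then (\<Sum>k. if (\<Sum>j\<le>k. X (Lifetime n j) \<omega>) < X (Service n) \<omega> then X (Repair n k) \<omega> else 0) else 0))"
    (is "_ = (\<lambda>\<omega>. _ + (if ?fin \<omega> then ?sum \<omega> else 0))")
  proof
    fix \<omega>
    have fin: "?fin \<omega> \<longleftrightarrow> finite (failures X n \<omega>)"
      by (simp add: failures_def finite_nat_set_iff_bounded)
    show "occupation X n \<omega> = X (Service n) \<omega> + (if ?fin \<omega> then ?sum \<omega> else 0)"
    proof (cases "finite (failures X n \<omega>)")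
      case True
      have "?sum \<omega> = (\<Sum>k\<in>failures X n \<omega>. X (Repair n k) \<omega>)"
        by (subst suminf_finite[OF True]) (auto simp: failures_def intro!: sum.cong)
      then show ?thesis using True fin by (simp add: occupation_def)
    next
      case False
      then have nf: "\<not> ?fin \<omega>" unfolding fin .
      show ?thesis unfolding occupation_def sum.infinite[OF False] if_not_P[OF nf] ..
    qed
  qed
  also have "\<dots> \<in> borel_measurable M" by measurable
  finally show ?thesis .
qed

text \<open>The \<open>restrict\<close> makes \<open>f\<close> and \<open>g\<close> functions on the
  product space over their own block; at each use it simplifies away, since they read only
  coordinates in that block.\<close>

lemma (in prob_space) indep_var_blocks:
  assumes "indep_vars M' X UNIV" "A \<inter> B = {}"
    and "f \<in> measurable (PiM A M') N1" "g \<in> measurable (PiM B M') N2"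
  shows "indep_var N1 (\<lambda>\<omega>. f (restrict (\<lambda>i. X i \<omega>) A)) N2 (\<lambda>\<omega>. g (restrict (\<lambda>i. X i \<omega>) B))"
  using indep_var_compose[OF indep_var_restrict[OF assms(1,2)] assms(3,4)] by (simp add: comp_def)

lemma (in prob_space) indep_vars_blocks:
  assumes "indep_vars M' X UNIV" "disjoint_family K"
    and "\<And>j. f j \<in> measurable (PiM (K j) M') (N j)"
  shows "indep_vars N (\<lambda>j \<omega>. f j (restrict (\<lambda>i. X i \<omega>) (K j))) UNIV"
  using indep_vars_compose2[OF indep_vars_restrict[OF assms(1) _ assms(2)] assms(3)] by simp

lemma (in prob_space) indep_vars_reindex_inj:
  assumes "indep_vars (\<lambda>_. N) X UNIV" "inj h"
  shows "indep_vars (\<lambda>_. N) (\<lambda>j. X (h j)) UNIV"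
proof -
  have "disjoint_family (\<lambda>j. {h j})"
    using \<open>inj h\<close> by (auto simp: disjoint_family_on_def inj_eq)
  from indep_vars_blocks[OF assms(1) this, of "\<lambda>j f. f (h j)" "\<lambda>_. N"]
  show ?thesis by simp
qed

section \<open>Occupation times\<close>

context unreliable_MG1
begin

lemma random_variable_source [measurable]: "X i \<in> borel_measurable M"
  using independent by (simp add: indep_vars_def)

lemma nonneg_service: "nonneg_distribution F\<^sub>S"
  using service_distribution service_nonneg
  by (simp add: nonneg_distribution_def nonneg_distribution_axioms_def)

lemma nonneg_repair: "nonneg_distribution F\<^sub>R"
  using repair_distribution repair_nonneg
  by (simp add: nonneg_distribution_def nonneg_distribution_axioms_def)

lemma AE_service_nonneg: "AE \<omega> in M. 0 \<le> X (Service n) \<omega>"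
  using service_nonneg unfolding service_law[of n, symmetric] by (subst (asm) AE_distr_iff) auto

lemma AE_repair_nonneg: "AE \<omega> in M. \<forall>k. 0 \<le> X (Repair n k) \<omega>"
proof -
  have "AE \<omega> in M. 0 \<le> X (Repair n k) \<omega>" for k
    using repair_nonneg unfolding repair_law[of n k, symmetric] by (subst (asm) AE_distr_iff) auto
  then show ?thesis by (simp add: AE_all_countable)
qed

lemma AE_lifetime_nonneg: "AE \<omega> in M. \<forall>k. 0 \<le> X (Lifetime n k) \<omega>"
proof -
  have "AE \<omega> in M. 0 \<le> X (Lifetime n k) \<omega>" for k
  proof -
    have "AE t in distr M lborel (X (Lifetime n k)). 0 \<le> t"
      unfolding distributed_distr_eq_density[OF lifetime_law]
      by (subst AE_density) (auto simp: exponential_density_def)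
    then show ?thesis by (subst (asm) AE_distr_iff) auto
  qed
  then show ?thesis by (simp add: AE_all_countable)
qed

definition failure_time :: "nat \<Rightarrow> nat \<Rightarrow> 'w \<Rightarrow> real" where
  "failure_time n k \<omega> = (\<Sum>j\<le>k. X (Lifetime n j) \<omega>)"

lemma measurable_failure_time [measurable]: "failure_time n k \<in> borel_measurable M"
  unfolding failure_time_def[abs_def] by measurable

text \<open>The indices agree: failure time k is a sum of k + 1 lifetimes, and
  \<open>erlang_density k\<close> is the density of k + 1 exponential summands.\<close>

lemma failure_time_erlang: "distributed M lborel (failure_time n k) (erlang_density k \<alpha>)"
proof -
  have "indep_vars (\<lambda>_. borel) (\<lambda>j. X (Lifetime n j)) {..k}"
    by (rule indep_vars_subset[OF indep_vars_reindex_inj[OF independent]]) (auto simp: inj_def)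
  from exponential_distributed_sum[OF _ _ failure_rate_pos lifetime_law this]
  show ?thesis by (simp add: failure_time_def[abs_def])
qed

lemma prob_failure_time_less:
  "measure (distr M borel (failure_time n k)) {..<x} = erlang_CDF k \<alpha> x"
proof -
  have "emeasure (distr M borel (failure_time n k)) {..<x} = emeasure (distr M lborel (failure_time n k)) {..<x}"
    by (simp add: emeasure_distr)
  also have "\<dots> = (\<integral>\<^sup>+t. ennreal (erlang_density k \<alpha> t) * indicator {..<x} t \<partial>lborel)"
    unfolding distributed_distr_eq_density[OF failure_time_erlang]
    by (subst emeasure_density) auto
  \<comment> \<open>A failure has to strike strictly before completion, whereas the distribution
    function includes the endpoint; a single point has Lebesgue measure 0.\<close>
  also have "\<dots> = (\<integral>\<^sup>+t. ennreal (erlang_density k \<alpha> t) * indicator {..x} t \<partial>lborel)"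
    using AE_lborel_singleton[of x] by (intro nn_integral_cong_AE) (auto split: split_indicator)
  also have "\<dots> = ennreal (erlang_CDF k \<alpha> x)"
    using failure_rate_pos by (rule nn_integral_erlang_density)
  finally show ?thesis
    using failure_rate_pos by (simp add: measure_def)
qed

lemma indep_service_failure_time: "indep_var borel (X (Service n)) borel (failure_time n k)"
proof -
  let ?f = "\<lambda>f. f (Service n) :: real" and ?g = "\<lambda>f. \<Sum>j\<le>k. f (Lifetime n j) :: real"
  have "indep_var borel (\<lambda>\<omega>. ?f (restrict (\<lambda>i. X i \<omega>) {Service n}))
      borel (\<lambda>\<omega>. ?g (restrict (\<lambda>i. X i \<omega>) (range (Lifetime n))))"
    by (rule indep_var_blocks[OF independent]) auto
  then show ?thesis by (simp add: failure_time_def[abs_def])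
qed

lemma integral_service_failure_time:
  assumes "0 \<le> Re s"
  shows "(\<integral>\<omega>. (if failure_time n k \<omega> < X (Service n) \<omega> then exp (- s * X (Service n) \<omega>) else 0) \<partial>M)
    = (\<integral>x. erlang_CDF k \<alpha> x *\<^sub>R exp (- s * complex_of_real x) \<partial>F\<^sub>S)"
proof -
  interpret S: nonneg_distribution F\<^sub>S by (rule nonneg_service)
  let ?T = "distr M borel (failure_time n k)"
  let ?g = "\<lambda>x t. (if t < x then exp (- s * complex_of_real x) else 0)"
  interpret T: real_distribution ?T by (rule real_distribution_distr) measurable
  interpret ST: pair_prob_space F\<^sub>S ?T ..
  have ST: "F\<^sub>S \<Otimes>\<^sub>M ?T = distr M (borel \<Otimes>\<^sub>M borel) (\<lambda>\<omega>. (X (Service n) \<omega>, failure_time n k \<omega>))"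
    using indep_service_failure_time[of n k] unfolding indep_var_distribution_eq service_law by simp
  have "AE z in F\<^sub>S \<Otimes>\<^sub>M ?T. 0 \<le> fst z"
  proof (rule ST.AE_pair_measure)
    show "AE x in F\<^sub>S. AE t in ?T. 0 \<le> fst (x, t)"
      using S.AE_nonneg by eventually_elim simp
  qed measurable
  then have "AE z in F\<^sub>S \<Otimes>\<^sub>M ?T. norm (?g (fst z) (snd z)) \<le> 1"
    by eventually_elim (auto intro: norm_exp_le_1[OF assms, simplified])
  then have int: "integrable (F\<^sub>S \<Otimes>\<^sub>M ?T) (\<lambda>(x, t). ?g x t)"
    by (intro ST.integrable_const_bound[where B=1]) (auto simp: case_prod_beta)
  have inner: "(\<integral>t. ?g x t \<partial>?T) = erlang_CDF k \<alpha> x *\<^sub>R exp (- s * complex_of_real x)" for x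
  proof -
    have "(\<integral>t. ?g x t \<partial>?T) = (\<integral>t. indicator {..<x} t *\<^sub>R exp (- s * complex_of_real x) \<partial>?T)"
      by (intro Bochner_Integration.integral_cong) auto
    also have "\<dots> = measure ?T {..<x} *\<^sub>R exp (- s * complex_of_real x)"
      by (subst integral_scaleR_left) (auto simp: T.emeasure_eq_measure)
    finally show ?thesis unfolding prob_failure_time_less .
  qed
  have "(\<integral>\<omega>. ?g (X (Service n) \<omega>) (failure_time n k \<omega>) \<partial>M) = (\<integral>(x, t). ?g x t \<partial>(F\<^sub>S \<Otimes>\<^sub>M ?T))"
    unfolding ST by (subst integral_distr) auto
  also have "\<dots> = (\<integral>x. \<integral>t. ?g x t \<partial>?T \<partial>F\<^sub>S)"
    by (rule ST.integral_fst[symmetric, OF int])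
  finally show ?thesis unfolding inner .
qed

lemma integral_repairs:
  assumes "0 \<le> Re s"
  shows "(\<integral>\<omega>. (\<Prod>j<m. exp (- s * complex_of_real (X (Repair n j) \<omega>))) \<partial>M) = laplace F\<^sub>R s ^ m"
proof -
  interpret R: nonneg_distribution F\<^sub>R by (rule nonneg_repair)
  have "indep_vars (\<lambda>_. borel) (\<lambda>j. X (Repair n j)) {..<m}"
    by (rule indep_vars_subset[OF indep_vars_reindex_inj[OF independent]]) (auto simp: inj_def)
  then have "indep_vars (\<lambda>_. borel) (\<lambda>j \<omega>. exp (- s * complex_of_real (X (Repair n j) \<omega>))) {..<m}"
    by (rule indep_vars_compose2[where Y="\<lambda>_ x. exp (- s * complex_of_real x)"]) measurable
  moreover have "integrable M (\<lambda>\<omega>. exp (- s * complex_of_real (X (Repair n j) \<omega>)))" for j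
    using R.integrable_laplace[OF assms] unfolding repair_law[of n j, symmetric]
    by (subst (asm) integrable_distr_eq) auto
  moreover have "(\<integral>\<omega>. exp (- s * complex_of_real (X (Repair n j) \<omega>)) \<partial>M) = laplace F\<^sub>R s" for j
    unfolding laplace_def repair_law[of n j, symmetric] by (subst integral_distr) auto
  ultimately show ?thesis
    by (subst indep_vars_lebesgue_integral) simp_all
qed

text \<open>Whether failure k occurs is decided by requirement and lifetimes, a block of sources
  disjoint from the repairs.\<close>

lemma indep_service_repairs:
  assumes [measurable]: "h \<in> borel_measurable (borel \<Otimes>\<^sub>M borel)"
  shows "indep_var borel (\<lambda>\<omega>. h (X (Service n) \<omega>, failure_time n k \<omega>))
      borel (\<lambda>\<omega>. \<Prod>j<m. exp (- s * complex_of_real (X (Repair n j) \<omega>)))"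
proof -
  let ?A = "insert (Service n) (range (Lifetime n))" and ?B = "range (Repair n)"
  have "indep_var borel (\<lambda>\<omega>. (\<lambda>f. h (f (Service n), \<Sum>j\<le>k. f (Lifetime n j))) (restrict (\<lambda>i. X i \<omega>) ?A))
      borel (\<lambda>\<omega>. (\<lambda>f. \<Prod>j<m. exp (- s * complex_of_real (f (Repair n j)))) (restrict (\<lambda>i. X i \<omega>) ?B))"
    by (rule indep_var_blocks[OF independent]) auto
  then show ?thesis by (simp add: failure_time_def[abs_def])
qed

text \<open>For the event of exactly \<open>m\<close> failures, k will be m and m - 1. The last two
  claims take the place of k = m - 1 when m = 0.\<close>

lemma integral_failure:
  assumes s: "0 \<le> Re s"
  shows "(\<integral>\<omega>. (if failure_time n k \<omega> < X (Service n) \<omega> then exp (- s * X (Service n) \<omega>) else 0)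
      * (\<Prod>j<m. exp (- s * complex_of_real (X (Repair n j) \<omega>))) \<partial>M)
    = (\<integral>x. erlang_CDF k \<alpha> x *\<^sub>R exp (- s * complex_of_real x) \<partial>F\<^sub>S) * laplace F\<^sub>R s ^ m" (is ?eq)
    and "integrable M (\<lambda>\<omega>. (if failure_time n k \<omega> < X (Service n) \<omega> then exp (- s * X (Service n) \<omega>) else 0)
      * (\<Prod>j<m. exp (- s * complex_of_real (X (Repair n j) \<omega>))))" (is ?int)
    and "(\<integral>\<omega>. exp (- s * X (Service n) \<omega>)
      * (\<Prod>j<m. exp (- s * complex_of_real (X (Repair n j) \<omega>))) \<partial>M)
    = laplace F\<^sub>S s * laplace F\<^sub>R s ^ m" (is ?eqS)
    and "integrable M (\<lambda>\<omega>. exp (- s * X (Service n) \<omega>)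
      * (\<Prod>j<m. exp (- s * complex_of_real (X (Repair n j) \<omega>))))" (is ?intS)
proof -
  let ?h = "\<lambda>(x, t). if t < x then exp (- s * complex_of_real x) else 0"
    and ?g = "\<lambda>(x, t::real). exp (- s * complex_of_real x)"
  have int_S: "integrable M (\<lambda>\<omega>. exp (- s * X (Service n) \<omega>))"
  proof (rule integrable_const_bound[where B=1])
    show "AE \<omega> in M. norm (exp (- s * X (Service n) \<omega>)) \<le> 1"
      using AE_service_nonneg by eventually_elim (rule norm_exp_le_1[OF s])
  qed measurable
  have int_F: "integrable M (\<lambda>\<omega>. if failure_time n k \<omega> < X (Service n) \<omega> then exp (- s * X (Service n) \<omega>) else 0)"
    by (rule Bochner_Integration.integrable_bound[OF int_S]) auto
  have int_R: "integrable M (\<lambda>\<omega>. \<Prod>j<m. exp (- s * complex_of_real (X (Repair n j) \<omega>)))"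
  proof (rule integrable_const_bound[where B=1])
    show "AE \<omega> in M. norm (\<Prod>j<m. exp (- s * complex_of_real (X (Repair n j) \<omega>))) \<le> 1"
      using AE_repair_nonneg[of n]
    proof eventually_elim
      case (elim \<omega>)
      then show ?case
        unfolding prod_norm[symmetric] by (intro prod_le_1 conjI norm_ge_zero norm_exp_le_1[OF s]) auto
    qed
  qed measurable
  have ind: "indep_var borel (\<lambda>\<omega>. if failure_time n k \<omega> < X (Service n) \<omega> then exp (- s * X (Service n) \<omega>) else 0)
      borel (\<lambda>\<omega>. \<Prod>j<m. exp (- s * complex_of_real (X (Repair n j) \<omega>)))"
  proof -
    have h: "?h \<in> borel_measurable (borel \<Otimes>\<^sub>M borel)" by measurable
    show ?thesis using indep_service_repairs[OF h, of n k s m] by (simp only: prod.case)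
  qed
  have ind0: "indep_var borel (\<lambda>\<omega>. exp (- s * X (Service n) \<omega>))
      borel (\<lambda>\<omega>. \<Prod>j<m. exp (- s * complex_of_real (X (Repair n j) \<omega>)))"
  proof -
    have h: "?g \<in> borel_measurable (borel \<Otimes>\<^sub>M borel)" by measurable
    show ?thesis using indep_service_repairs[OF h, of n k s m] by (simp only: prod.case)
  qed
  show ?eq
    unfolding indep_var_lebesgue_integral[OF ind int_F int_R]
      integral_service_failure_time[OF s] integral_repairs[OF s] ..
  show ?int by (rule indep_var_integrable[OF ind int_F int_R])
  have "(\<integral>\<omega>. exp (- s * X (Service n) \<omega>) \<partial>M) = laplace F\<^sub>S s"
    unfolding laplace_def service_law[of n, symmetric] by (subst integral_distr) auto
  then show ?eqS
    unfolding indep_var_lebesgue_integral[OF ind0 int_S int_R] integral_repairs[OF s] by simp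
  show ?intS by (rule indep_var_integrable[OF ind0 int_S int_R])
qed

lemma failures_eq: "failures X n \<omega> = {k. failure_time n k \<omega> < X (Service n) \<omega>}"
  by (simp add: failures_def failure_time_def)

text \<open>Nonnegative lifetimes make the failure set downward closed. It is all of the naturals
  with probability at most that of failure k, for every k, and this tends to 0 by
  \<open>erlang_CDF_tendsto_0\<close>.\<close>

lemma AE_failures_initial_segment: "AE \<omega> in M. \<exists>N. failures X n \<omega> = {..<N}"
proof -
  interpret S: nonneg_distribution F\<^sub>S by (rule nonneg_service)
  let ?E = "\<lambda>k. {\<omega> \<in> space M. failure_time n k \<omega> < X (Service n) \<omega>}"
  let ?U = "{\<omega> \<in> space M. \<forall>k. failure_time n k \<omega> < X (Service n) \<omega>}"
  have prob_E: "prob (?E k) = (\<integral>x. erlang_CDF k \<alpha> x \<partial>F\<^sub>S)" for k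
  proof -
    have "complex_of_real (prob (?E k)) = (\<integral>\<omega>. complex_of_real (indicator (?E k) \<omega>) \<partial>M)"
      by simp
    \<comment> \<open>The exponential equals 1: probabilities are the case s = 0 of
      \<open>integral_service_failure_time\<close>.\<close>
    also have "\<dots> = (\<integral>\<omega>. (if failure_time n k \<omega> < X (Service n) \<omega> then exp (- 0 * complex_of_real (X (Service n) \<omega>)) else 0) \<partial>M)"
      by (intro Bochner_Integration.integral_cong) auto
    also have "\<dots> = (\<integral>x. complex_of_real (erlang_CDF k \<alpha> x) \<partial>F\<^sub>S)"
      using integral_service_failure_time[of 0 n k] by (simp add: scaleR_conv_of_real)
    finally show ?thesis by (simp only: integral_complex_of_real of_real_eq_iff)
  qed
  have "(\<lambda>k. \<integral>x. erlang_CDF k \<alpha> x \<partial>F\<^sub>S) \<longlonglongrightarrow> (\<integral>x. 0 \<partial>F\<^sub>S)"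
  proof (rule integral_dominated_convergence[where w="\<lambda>_. 1"])
    show "AE x in F\<^sub>S. (\<lambda>k. erlang_CDF k \<alpha> x) \<longlonglongrightarrow> 0"
      using S.AE_nonneg by eventually_elim (rule erlang_CDF_tendsto_0)
    show "AE x in F\<^sub>S. norm (erlang_CDF k \<alpha> x) \<le> 1" for k
      using failure_rate_pos erlang_CDF_le_1[of \<alpha> k] by simp
  qed auto
  then have "(\<lambda>k. prob (?E k)) \<longlonglongrightarrow> 0" unfolding prob_E by simp
  then have "prob ?U \<le> 0"
  proof (rule LIMSEQ_le_const, intro exI[of _ 0] allI impI)
    show "prob ?U \<le> prob (?E k)" for k by (rule finite_measure_mono) auto
  qed
  then have "prob ?U = 0" by (simp add: measure_le_0_iff)
  then have "AE \<omega> in M. \<not> (\<forall>k. failure_time n k \<omega> < X (Service n) \<omega>)"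
    by (subst (asm) prob_eq_0) auto
  with AE_lifetime_nonneg[of n] show ?thesis
  proof eventually_elim
    case (elim \<omega>)
    have mono: "failure_time n i \<omega> \<le> failure_time n j \<omega>" if "i \<le> j" for i j
      unfolding failure_time_def using elim(1) that by (intro sum_mono2) auto
    have "failures X n \<omega> = UNIV \<or> (\<exists>N. failures X n \<omega> = {..<N})"
    proof (rule down_closed_nat_cases)
      show "i \<in> failures X n \<omega>" if "j \<in> failures X n \<omega>" "i \<le> j" for i j
        using that mono[of i j] by (auto simp: failures_eq)
    qed
    with elim(2) show ?case by (auto simp: failures_eq)
  qed
qed

section \<open>Poisson weights and the split by the number of failures\<close>

definition poisson_weight :: "nat \<Rightarrow> real \<Rightarrow> real" where
  "poisson_weight m x = (\<alpha> * x) ^ m * exp (- \<alpha> * x) / fact m"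

lemma borel_measurable_poisson_weight [measurable]: "poisson_weight m \<in> borel_measurable borel"
  unfolding poisson_weight_def[abs_def] by measurable

text \<open>The generating function of a Poisson variable with mean \<alpha> x. At z =
  \<open>laplace F\<^sub>R s\<close>, one factor per repair, it yields the summand \<alpha> (1 - z)
  in the argument of the service transform.\<close>

lemma poisson_weight_sums: "(\<lambda>m. poisson_weight m x *\<^sub>R z ^ m) sums exp (- of_real (\<alpha> * x) * (1 - z))"
  for z :: complex
proof -
  have "(\<lambda>m. complex_of_real (exp (- \<alpha> * x)) * ((of_real (\<alpha> * x) * z) ^ m /\<^sub>R fact m))
      sums (complex_of_real (exp (- \<alpha> * x)) * exp (of_real (\<alpha> * x) * z))"
    by (intro sums_mult exp_converges)
  moreover have "complex_of_real (exp (- \<alpha> * x)) * exp (of_real (\<alpha> * x) * z) = exp (- of_real (\<alpha> * x) * (1 - z))"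
    unfolding exp_of_real[symmetric] exp_add[symmetric] by (simp add: right_diff_distrib)
  moreover have "complex_of_real (exp (- \<alpha> * x)) * ((of_real (\<alpha> * x) * z) ^ m /\<^sub>R fact m)
      = poisson_weight m x *\<^sub>R z ^ m" for m
    by (simp add: poisson_weight_def scaleR_conv_of_real power_mult_distrib field_simps)
  ultimately show ?thesis by simp
qed

lemma poisson_weight_nonneg: "0 \<le> x \<Longrightarrow> 0 \<le> poisson_weight m x"
  using failure_rate_pos by (simp add: poisson_weight_def)

text \<open>Duality of Poisson counts and Erlang times: at most k failures strike within processing
  time x exactly when failure time k is not below x.\<close>

lemma sum_poisson_weight: "0 \<le> x \<Longrightarrow> (\<Sum>m\<le>k. poisson_weight m x) = 1 - erlang_CDF k \<alpha> x"
  by (simp add: poisson_weight_def erlang_CDF_def)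

lemma sum_poisson_weight_le_1: "0 \<le> x \<Longrightarrow> (\<Sum>m<k. poisson_weight m x) \<le> 1"
proof -
  assume x: "0 \<le> x"
  have "(\<Sum>m<k. poisson_weight m x) \<le> (\<Sum>m\<le>k. poisson_weight m x)"
    using x by (intro sum_mono2 poisson_weight_nonneg) auto
  also have "\<dots> \<le> 1"
    using sum_poisson_weight[OF x] erlang_CDF_nonneg[OF failure_rate_pos, of k x] by simp
  finally show ?thesis .
qed

lemma integrable_poisson_weight:
  assumes "0 \<le> Re s"
  shows "integrable F\<^sub>S (\<lambda>x. poisson_weight m x *\<^sub>R exp (- s * complex_of_real x))"
proof -
  interpret S: nonneg_distribution F\<^sub>S by (rule nonneg_service)
  show ?thesis
  proof (rule S.integrable_const_bound[where B=1])
    show "AE x in F\<^sub>S. norm (poisson_weight m x *\<^sub>R exp (- s * complex_of_real x)) \<le> 1"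
      using S.AE_nonneg
    proof eventually_elim
      case (elim x)
      have "poisson_weight m x \<le> (\<Sum>m<Suc m. poisson_weight m x)"
        using elim by (simp add: sum_nonneg poisson_weight_nonneg)
      also have "\<dots> \<le> 1" using elim by (rule sum_poisson_weight_le_1)
      finally show ?case
        using norm_exp_le_1[OF assms elim] poisson_weight_nonneg[OF elim, of m]
        by (simp only: norm_scaleR) (simp add: mult_le_one)
    qed
  qed measurable
qed

text \<open>The contribution of exactly \<open>m\<close> failures to the transform. Requiring the
  set to be \<open>{..<m}\<close> also tells which repairs occur, namely the first
  \<open>m\<close>.\<close>

definition failure_count_term :: "nat \<Rightarrow> complex \<Rightarrow> nat \<Rightarrow> 'w \<Rightarrow> complex" where
  "failure_count_term n s m \<omega> =
    (if failures X n \<omega> = {..<m} then exp (- s * complex_of_real (occupation X n \<omega>)) else 0)"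

text \<open>On the event of exactly \<open>m\<close> failures the exponential splits into a factor
  for the requirement and a product over the first \<open>m\<close> repairs; independence then
  separates the two.\<close>

lemma integral_failure_count_term:
  assumes s: "0 \<le> Re s"
  shows "(\<integral>\<omega>. failure_count_term n s m \<omega> \<partial>M)
      = (\<integral>x. poisson_weight m x *\<^sub>R exp (- s * complex_of_real x) \<partial>F\<^sub>S) * laplace F\<^sub>R s ^ m" (is ?eq)
    and "integrable M (failure_count_term n s m)" (is ?int)
proof -
  interpret S: nonneg_distribution F\<^sub>S by (rule nonneg_service)
  define e where "e \<omega> = exp (- s * complex_of_real (X (Service n) \<omega>))" for \<omega>
  define P where "P \<omega> = (\<Prod>j<m. exp (- s * complex_of_real (X (Repair n j) \<omega>)))" for \<omega>
  define J where "J k \<omega> = (if failure_time n k \<omega> < X (Service n) \<omega> then e \<omega> else 0)" for k \<omega>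
  \<comment> \<open>Exactly \<open>m\<close> failures occur when failure time \<open>m - 1\<close> precedes completion (vacuous if \<open>m = 0\<close>)
    but failure time \<open>m\<close> does not, hence a difference of two Erlang distribution functions.\<close>
  define J' where "J' = (case m of 0 \<Rightarrow> e | Suc k \<Rightarrow> J k)"
  define q where "q x = (case m of 0 \<Rightarrow> 1 | Suc k \<Rightarrow> erlang_CDF k \<alpha> x)" for x
  have [measurable]: "q \<in> borel_measurable borel"
    unfolding q_def[abs_def] by (cases m) auto
  note F = integral_failure[OF s, where n=n and m=m, folded e_def P_def, folded J_def]
  have J': "(\<integral>\<omega>. J' \<omega> * P \<omega> \<partial>M) = (\<integral>x. q x *\<^sub>R exp (- s * complex_of_real x) \<partial>F\<^sub>S) * laplace F\<^sub>R s ^ m"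
    "integrable M (\<lambda>\<omega>. J' \<omega> * P \<omega>)"
    using F by (cases m; simp add: J'_def q_def laplace_def)+
  have term_eq: "AE \<omega> in M. failure_count_term n s m \<omega> = J' \<omega> * P \<omega> - J m \<omega> * P \<omega>"
    using AE_failures_initial_segment[of n]
  proof eventually_elim
    case (elim \<omega>)
    then obtain N where N: "failures X n \<omega> = {..<N}" by blast
    have ft: "failure_time n k \<omega> < X (Service n) \<omega> \<longleftrightarrow> k < N" for k
      using N by (auto simp: failures_eq)
    have "exp (- s * complex_of_real (occupation X n \<omega>)) = e \<omega> * P \<omega>" if "m = N"
      by (simp add: occupation_def N that e_def P_def exp_add[symmetric] exp_sum[symmetric] sum_negf
        sum_distrib_left distrib_left)
    moreover have "{..<N} = {..<m} \<longleftrightarrow> m = N" by auto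
    ultimately show ?case
      by (cases m) (auto simp: failure_count_term_def N J'_def J_def ft)
  qed
  have [measurable]: "occupation X n \<in> borel_measurable M"
    by (rule borel_measurable_occupation) measurable
  have meas: "failure_count_term n s m \<in> borel_measurable M"
    \<comment> \<open>Spelled out elementwise, equality of the two sets becomes a countable
      conjunction of measurable conditions.\<close>
    unfolding failure_count_term_def[abs_def] failures_eq set_eq_iff mem_Collect_eq by measurable
  have int: "integrable M (\<lambda>\<omega>. J' \<omega> * P \<omega> - J m \<omega> * P \<omega>)"
    using J'(2) F(2) by (rule Bochner_Integration.integrable_diff)
  show ?int
    using int meas term_eq by (subst integrable_cong_AE) auto
  have int_erl: "integrable F\<^sub>S (\<lambda>x. f x *\<^sub>R exp (- s * complex_of_real x))"
    if "f \<in> borel_measurable borel" "\<And>x. \<bar>f x\<bar> \<le> 1" for f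
  proof (rule S.integrable_const_bound[where B=1])
    show "AE x in F\<^sub>S. norm (f x *\<^sub>R exp (- s * complex_of_real x)) \<le> 1"
      using S.AE_nonneg
    proof eventually_elim
      case (elim x)
      then show ?case using norm_exp_le_1[OF s elim] that(2)[of x]
        by (simp only: norm_scaleR) (simp add: mult_le_one)
    qed
  qed (use that(1) in measurable)
  have q_bound: "\<bar>q x\<bar> \<le> 1" for x
    using erlang_CDF_nonneg[OF failure_rate_pos] erlang_CDF_le_1[OF failure_rate_pos]
    by (cases m) (auto simp: q_def)
  have CDF_bound: "\<bar>erlang_CDF m \<alpha> x\<bar> \<le> 1" for x
    using erlang_CDF_nonneg[OF failure_rate_pos] erlang_CDF_le_1[OF failure_rate_pos] by simp
  have "(\<integral>\<omega>. failure_count_term n s m \<omega> \<partial>M) = (\<integral>\<omega>. J' \<omega> * P \<omega> - J m \<omega> * P \<omega> \<partial>M)"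
    using meas int term_eq by (intro integral_cong_AE) auto
  also have "\<dots> = ((\<integral>x. q x *\<^sub>R exp (- s * complex_of_real x) \<partial>F\<^sub>S)
      - (\<integral>x. erlang_CDF m \<alpha> x *\<^sub>R exp (- s * complex_of_real x) \<partial>F\<^sub>S)) * laplace F\<^sub>R s ^ m"
    unfolding Bochner_Integration.integral_diff[OF J'(2) F(2)] J'(1) F(1) left_diff_distrib ..
  also have "(\<integral>x. q x *\<^sub>R exp (- s * complex_of_real x) \<partial>F\<^sub>S)
      - (\<integral>x. erlang_CDF m \<alpha> x *\<^sub>R exp (- s * complex_of_real x) \<partial>F\<^sub>S)
      = (\<integral>x. q x *\<^sub>R exp (- s * complex_of_real x) - erlang_CDF m \<alpha> x *\<^sub>R exp (- s * complex_of_real x) \<partial>F\<^sub>S)"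
    by (rule Bochner_Integration.integral_diff[symmetric]; rule int_erl; (rule q_bound CDF_bound | measurable))
  also have "\<dots> = (\<integral>x. poisson_weight m x *\<^sub>R exp (- s * complex_of_real x) \<partial>F\<^sub>S)"
  proof (rule integral_cong_AE)
    show "AE x in F\<^sub>S. q x *\<^sub>R exp (- s * complex_of_real x) - erlang_CDF m \<alpha> x *\<^sub>R exp (- s * complex_of_real x)
        = poisson_weight m x *\<^sub>R exp (- s * complex_of_real x)"
      using S.AE_nonneg
    proof eventually_elim
      case (elim x)
      then have "q x - erlang_CDF m \<alpha> x = poisson_weight m x"
        using sum_poisson_weight[OF elim, of m] sum_poisson_weight[OF elim, of "m - 1"]
        by (cases m) (auto simp: q_def)
      then show ?case by (simp only: scaleR_diff_left[symmetric])
    qed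
  qed measurable
  finally show ?eq .
qed

end

section \<open>Transform and mean of the occupation time\<close>

context unreliable_MG1
begin

lemma random_variable_occupation [measurable]: "occupation X n \<in> borel_measurable M"
  by (rule borel_measurable_occupation) measurable

lemma AE_occupation_nonneg: "AE \<omega> in M. 0 \<le> occupation X n \<omega>"
  using AE_service_nonneg[of n] AE_repair_nonneg[of n]
  by eventually_elim (auto simp: occupation_def intro!: add_nonneg_nonneg sum_nonneg)

text \<open>The sum over fewer than \<open>K\<close> failures is computed in two ways and
  \<open>K\<close> tends to infinity on both sides. Both limits are dominated by 1: on the side of
  \<open>M\<close> at most one term is almost surely nonzero, and on the side of
  \<open>F\<^sub>S\<close> the Poisson weights sum to at most 1 while \<open>?z\<close> has modulus
  at most 1.\<close>

lemma laplace_occupation: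
  assumes s: "0 \<le> Re s"
  shows "laplace (distr M borel (occupation X n)) s = laplace F\<^sub>S (s + \<alpha> * (1 - laplace F\<^sub>R s))"
proof -
  interpret S: nonneg_distribution F\<^sub>S by (rule nonneg_service)
  interpret R: nonneg_distribution F\<^sub>R by (rule nonneg_repair)
  let ?z = "laplace F\<^sub>R s"
  have lim_term: "(\<lambda>K. \<integral>\<omega>. (\<Sum>m<K. failure_count_term n s m \<omega>) \<partial>M)
      \<longlonglongrightarrow> (\<integral>\<omega>. exp (- s * complex_of_real (occupation X n \<omega>)) \<partial>M)"
  proof (rule integral_dominated_convergence[where w="\<lambda>_. 1"])
    have part: "(\<Sum>m<K. failure_count_term n s m \<omega>)
        = (if N < K then exp (- s * complex_of_real (occupation X n \<omega>)) else 0)"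
      if N: "failures X n \<omega> = {..<N}" for N K \<omega>
    proof -
      have "failure_count_term n s m \<omega>
          = (if m = N then exp (- s * complex_of_real (occupation X n \<omega>)) else 0)" for m
        by (auto simp: failure_count_term_def N)
      then show ?thesis by simp
    qed
    show "AE \<omega> in M. (\<lambda>K. \<Sum>m<K. failure_count_term n s m \<omega>)
        \<longlonglongrightarrow> exp (- s * complex_of_real (occupation X n \<omega>))"
      using AE_failures_initial_segment[of n]
    proof eventually_elim
      case (elim \<omega>)
      then obtain N where N: "failures X n \<omega> = {..<N}" by blast
      have "eventually (\<lambda>K. (\<Sum>m<K. failure_count_term n s m \<omega>)
          = exp (- s * complex_of_real (occupation X n \<omega>))) sequentially"
        using eventually_gt_at_top[of N] by eventually_elim (simp add: part[OF N])
      then show ?case by (rule tendsto_eventually)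
    qed
    show "AE \<omega> in M. norm (\<Sum>m<K. failure_count_term n s m \<omega>) \<le> 1" for K
      using AE_failures_initial_segment[of n] AE_occupation_nonneg[of n]
    proof eventually_elim
      case (elim \<omega>)
      then obtain N where N: "failures X n \<omega> = {..<N}" by blast
      show ?case unfolding part[OF N] using norm_exp_le_1[OF s elim(2)] by (cases "N < K") (simp_all only: if_True if_False norm_zero zero_le_one)
    qed
    show "(\<lambda>\<omega>. \<Sum>m<K. failure_count_term n s m \<omega>) \<in> borel_measurable M" for K
      using integral_failure_count_term(2)[OF s] by (intro borel_measurable_sum) auto
  qed auto
  have sum_eq: "(\<integral>\<omega>. (\<Sum>m<K. failure_count_term n s m \<omega>) \<partial>M)
      = (\<integral>x. (\<Sum>m<K. poisson_weight m x *\<^sub>R ?z ^ m) * exp (- s * complex_of_real x) \<partial>F\<^sub>S)" for K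
  proof -
    have "(\<integral>\<omega>. (\<Sum>m<K. failure_count_term n s m \<omega>) \<partial>M)
        = (\<Sum>m<K. (\<integral>x. poisson_weight m x *\<^sub>R exp (- s * complex_of_real x) \<partial>F\<^sub>S) * ?z ^ m)"
      by (simp only: Bochner_Integration.integral_sum[OF integral_failure_count_term(2)[OF s]]
          integral_failure_count_term(1)[OF s])
    also have "\<dots> = (\<Sum>m<K. \<integral>x. poisson_weight m x *\<^sub>R exp (- s * complex_of_real x) * ?z ^ m \<partial>F\<^sub>S)"
      by (simp only: integral_mult_left_zero)
    also have "\<dots> = (\<integral>x. (\<Sum>m<K. poisson_weight m x *\<^sub>R exp (- s * complex_of_real x) * ?z ^ m) \<partial>F\<^sub>S)"
      by (rule Bochner_Integration.integral_sum[symmetric])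
        (rule integrable_mult_left[OF integrable_poisson_weight[OF s]])
    also have "(\<lambda>x. \<Sum>m<K. poisson_weight m x *\<^sub>R exp (- s * complex_of_real x) * ?z ^ m)
        = (\<lambda>x. (\<Sum>m<K. poisson_weight m x *\<^sub>R ?z ^ m) * exp (- s * complex_of_real x))"
      by (rule ext) (simp add: sum_distrib_left mult.commute)
    finally show ?thesis .
  qed
  have "(\<lambda>K. \<integral>x. (\<Sum>m<K. poisson_weight m x *\<^sub>R ?z ^ m) * exp (- s * complex_of_real x) \<partial>F\<^sub>S)
      \<longlonglongrightarrow> (\<integral>x. exp (- (s + \<alpha> * (1 - ?z)) * complex_of_real x) \<partial>F\<^sub>S)"
  proof (rule integral_dominated_convergence[where w="\<lambda>_. 1"])
    show "AE x in F\<^sub>S. (\<lambda>K. (\<Sum>m<K. poisson_weight m x *\<^sub>R ?z ^ m) * exp (- s * complex_of_real x))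
        \<longlonglongrightarrow> exp (- (s + \<alpha> * (1 - ?z)) * complex_of_real x)"
    proof (rule AE_I2)
      fix x
      have "exp (- of_real (\<alpha> * x) * (1 - ?z)) * exp (- s * complex_of_real x)
          = exp (- (s + \<alpha> * (1 - ?z)) * complex_of_real x)"
        unfolding exp_add[symmetric] by (simp add: algebra_simps)
      then show "(\<lambda>K. (\<Sum>m<K. poisson_weight m x *\<^sub>R ?z ^ m) * exp (- s * complex_of_real x))
        \<longlonglongrightarrow> exp (- (s + \<alpha> * (1 - ?z)) * complex_of_real x)"
        using tendsto_mult[OF poisson_weight_sums[of x ?z, unfolded sums_def] tendsto_const[of "exp (- s * complex_of_real x)"]]
        by (simp only:)
    qed
    show "AE x in F\<^sub>S. norm ((\<Sum>m<K. poisson_weight m x *\<^sub>R ?z ^ m) * exp (- s * complex_of_real x)) \<le> 1" for K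
      using S.AE_nonneg
    proof eventually_elim
      case (elim x)
      have "norm (\<Sum>m<K. poisson_weight m x *\<^sub>R ?z ^ m) \<le> (\<Sum>m<K. poisson_weight m x)"
      proof (rule order_trans[OF norm_sum], rule sum_mono)
        fix m
        have "norm ?z ^ m \<le> 1"
          by (rule power_le_one) (auto intro: R.norm_laplace_le_1[OF s])
        then show "norm (poisson_weight m x *\<^sub>R ?z ^ m) \<le> poisson_weight m x"
          using poisson_weight_nonneg[OF elim, of m]
          by (simp add: norm_power mult_left_le)
      qed
      also have "\<dots> \<le> 1" by (rule sum_poisson_weight_le_1[OF elim])
      finally show ?case
        using norm_exp_le_1[OF s elim] unfolding norm_mult by (intro mult_le_one norm_ge_zero)
    qed
  qed auto
  then have "(\<integral>\<omega>. exp (- s * complex_of_real (occupation X n \<omega>)) \<partial>M)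
      = laplace F\<^sub>S (s + \<alpha> * (1 - ?z))"
    using lim_term unfolding sum_eq laplace_def[of "F\<^sub>S"] by (rule LIMSEQ_unique[rotated])
  then show ?thesis
    unfolding laplace_def[of "distr _ _ _"] by (subst integral_distr) auto
qed

definition occupation_law :: "real measure" where
  "occupation_law = distr M borel (occupation X 0)"

text \<open>The right-hand side of \<open>laplace_occupation\<close> does not depend on
  \<open>n\<close>, so uniqueness of transforms shows the occupation times to be identically
  distributed.\<close>

lemma distr_occupation: "distr M borel (occupation X n) = occupation_law"
  unfolding occupation_law_def
proof (rule laplace_unique)
  show "laplace (distr M borel (occupation X n)) (\<i> * t) = laplace (distr M borel (occupation X 0)) (\<i> * t)"
    for t :: real by (simp add: laplace_occupation)
qed auto

lemma nonneg_occupation_law: "nonneg_distribution occupation_law"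
proof -
  interpret C: real_distribution occupation_law
    unfolding occupation_law_def by (rule real_distribution_distr) measurable
  show ?thesis
  proof
    show "AE t in occupation_law. 0 \<le> t"
      unfolding occupation_law_def using AE_occupation_nonneg[of 0] by (subst AE_distr_iff) auto
  qed
qed

lemma LST_occupation_law:
  assumes "0 \<le> a"
  shows "LST occupation_law a = LST F\<^sub>S (a + \<alpha> * (1 - LST F\<^sub>R a))"
proof -
  have "complex_of_real (LST occupation_law a) = laplace occupation_law (of_real a)"
    by (rule laplace_of_real[symmetric])
  also have "\<dots> = laplace F\<^sub>S (of_real a + \<alpha> * (1 - laplace F\<^sub>R (of_real a)))"
    unfolding occupation_law_def by (rule laplace_occupation) (use assms in simp)
  also have "of_real a + \<alpha> * (1 - laplace F\<^sub>R (of_real a)) = complex_of_real (a + \<alpha> * (1 - LST F\<^sub>R a))"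
    by (simp add: laplace_of_real)
  finally show ?thesis unfolding laplace_of_real of_real_eq_iff .
qed

text \<open>The chain rule at 0, in place of an expectation of the random sum of repairs: the slope
  of the transform is the slope for \<open>F\<^sub>S\<close> at g(a) times g(a) / a. Bounding both
  slopes by the means first gives integrability.\<close>

lemma mean_occupation_law:
  shows "integrable occupation_law (\<lambda>t. t)"
    and "mean occupation_law = mean F\<^sub>S * (1 + \<alpha> * mean F\<^sub>R)"
proof -
  interpret S: nonneg_distribution F\<^sub>S by (rule nonneg_service)
  interpret R: nonneg_distribution F\<^sub>R by (rule nonneg_repair)
  interpret C: nonneg_distribution occupation_law by (rule nonneg_occupation_law)
  define g where "g a = a + \<alpha> * (1 - LST F\<^sub>R a)" for a
  have mean_S: "0 \<le> mean F\<^sub>S" unfolding mean_def by (rule integral_nonneg_AE[OF S.AE_nonneg])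
  have g_pos: "0 < g a" if "0 < a" for a
    using that R.LST_le_1[of a] failure_rate_pos by (simp add: g_def add_pos_nonneg)
  have bound: "1 - LST occupation_law a \<le> a * (mean F\<^sub>S * (1 + \<alpha> * mean F\<^sub>R))" if "0 < a" for a
  proof -
    have "1 - LST occupation_law a \<le> g a * mean F\<^sub>S"
      using S.one_minus_LST_le[OF _ service_finite_mean, of "g a"] g_pos[OF that] that
      by (simp add: LST_occupation_law g_def)
    also have "\<dots> \<le> (a + \<alpha> * (a * mean F\<^sub>R)) * mean F\<^sub>S"
      using R.one_minus_LST_le[OF _ repair_finite_mean, of a] that failure_rate_pos mean_S
      by (auto simp: g_def intro!: mult_right_mono)
    finally show ?thesis by (simp add: algebra_simps)
  qed
  show int: "integrable occupation_law (\<lambda>t. t)"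
    using bound by (rule C.integrable_of_LST_slope_bound)
  define u where "u n = 1 / real (Suc n)" for n
  have u: "u \<longlonglongrightarrow> 0" "\<And>n. 0 < u n" "\<And>n. 0 \<le> u n"
    unfolding u_def by (rule LIMSEQ_Suc[OF lim_1_over_n]) auto
  have g_lim: "(\<lambda>n. g (u n)) \<longlonglongrightarrow> 0"
  proof -
    have "(\<lambda>n. g (u n)) \<longlonglongrightarrow> 0 + \<alpha> * (1 - 1)"
      unfolding g_def by (intro tendsto_intros u R.LST_tendsto_1)
    then show ?thesis by simp
  qed
  have "(\<lambda>n. (1 - LST F\<^sub>S (g (u n))) / g (u n) * (1 + \<alpha> * ((1 - LST F\<^sub>R (u n)) / u n)))
      \<longlonglongrightarrow> mean F\<^sub>S * (1 + \<alpha> * mean F\<^sub>R)"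
    by (intro tendsto_intros S.LST_slope_tendsto_mean[OF service_finite_mean g_lim]
        R.LST_slope_tendsto_mean[OF repair_finite_mean u(1)] g_pos u(2))
  moreover have "(1 - LST F\<^sub>S (g (u n))) / g (u n) * (1 + \<alpha> * ((1 - LST F\<^sub>R (u n)) / u n))
      = (1 - LST occupation_law (u n)) / u n" for n
  proof -
    have "1 + \<alpha> * ((1 - LST F\<^sub>R (u n)) / u n) = g (u n) / u n"
      using u(2)[of n] by (simp add: g_def field_simps)
    moreover have "LST occupation_law (u n) = LST F\<^sub>S (g (u n))"
      using u(3)[of n] by (simp add: LST_occupation_law g_def)
    ultimately show ?thesis using g_pos[OF u(2)[of n]] by simp
  qed
  ultimately have "(\<lambda>n. (1 - LST occupation_law (u n)) / u n) \<longlonglongrightarrow> mean F\<^sub>S * (1 + \<alpha> * mean F\<^sub>R)"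
    by (simp only:)
  then show "mean occupation_law = mean F\<^sub>S * (1 + \<alpha> * mean F\<^sub>R)"
    using C.LST_slope_tendsto_mean[OF int u(1,2)] by (rule LIMSEQ_unique[rotated])
qed

end

section \<open>The Markov chain of sojourn times\<close>

lemma sojourn_0: "sojourn X v 0 \<omega> = max 0 v + occupation X 0 \<omega>"
  by (simp add: sojourn_def arrival_def)

lemma sojourn_Suc: "sojourn X v (Suc n) \<omega> = max 0 (sojourn X v n \<omega> - X (Gap n) \<omega>) + occupation X (Suc n) \<omega>"
  by (simp add: sojourn_def arrival_def max_def)

text \<open>\<open>Inl n\<close> indexes the gap after packet \<open>n\<close>, and \<open>Inr n\<close> its occupation time.\<close>

primrec sojourn_rec :: "real \<Rightarrow> nat \<Rightarrow> (nat + nat \<Rightarrow> real) \<Rightarrow> real" where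
  "sojourn_rec v 0 z = max 0 v + z (Inr 0)"
| "sojourn_rec v (Suc n) z = max 0 (sojourn_rec v n z - z (Inl n)) + z (Inr (Suc n))"

text \<open>The coordinates that \<open>sojourn_rec v n\<close> reads. Gap n and occupation time n +
  1 lie outside, which gives the independence needed for the next step.\<close>

definition past :: "nat \<Rightarrow> (nat + nat) set" where
  "past n = Inl ` {..<n} \<union> Inr ` {..n}"

lemma sojourn_rec_restrict: "past n \<subseteq> A \<Longrightarrow> sojourn_rec v n (restrict z A) = sojourn_rec v n z"
proof (induction n)
  case (Suc n)
  then have "past n \<subseteq> A" "Inl n \<in> A" "Inr (Suc n) \<in> A" by (auto simp: past_def)
  then show ?case using Suc.IH by simp
qed (auto simp: past_def)

lemma borel_measurable_sojourn_rec:
  "past n \<subseteq> A \<Longrightarrow> sojourn_rec v n \<in> borel_measurable (PiM A (\<lambda>_. borel))"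
proof (induction n)
  case 0
  then have "Inr 0 \<in> A" by (auto simp: past_def)
  then have [measurable]: "(\<lambda>z. z (Inr 0)) \<in> borel_measurable (PiM A (\<lambda>_. borel))" by measurable
  show ?case by simp
next
  case (Suc n)
  then have *: "past n \<subseteq> A" "Inl n \<in> A" "Inr (Suc n) \<in> A" by (auto simp: past_def)
  have [measurable]: "sojourn_rec v n \<in> borel_measurable (PiM A (\<lambda>_. borel))"
    by (rule Suc.IH) fact
  have [measurable]: "(\<lambda>z. z (Inl n)) \<in> borel_measurable (PiM A (\<lambda>_. borel))"
    "(\<lambda>z. z (Inr (Suc n))) \<in> borel_measurable (PiM A (\<lambda>_. borel))"
    using * by measurable
  show ?case by simp
qed

section \<open>Transition of the chain through iterated integrals\<close>

text \<open>Laws are compared through nonnegative integrals, so that Fubini can be used on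
  convolutions and products without integrability conditions.\<close>

lemma measure_eqI_nn_integral:
  assumes "sets M = sets N"
    and "\<And>f. f \<in> borel_measurable M \<Longrightarrow> (\<integral>\<^sup>+x. f x \<partial>M) = (\<integral>\<^sup>+x. f x \<partial>N)"
  shows "M = N"
proof (rule measure_eqI)
  fix A assume A: "A \<in> sets M"
  then show "emeasure M A = emeasure N A"
    using assms(2)[of "indicator A"] assms(1) by simp
qed fact

lemma nn_integral_waiting:
  assumes "real_distribution \<mu>" "0 < lam" and [measurable]: "f \<in> borel_measurable borel"
  shows "(\<integral>\<^sup>+x. f x \<partial>waiting lam \<mu>)
    = (\<integral>\<^sup>+w. \<integral>\<^sup>+g. f (max 0 (w - g)) \<partial>density lborel (exponential_density lam) \<partial>\<mu>)"
proof -
  let ?E = "density lborel (exponential_density lam)"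
  interpret \<mu>: real_distribution \<mu> by fact
  interpret E: prob_space ?E
    using \<open>0 < lam\<close> by (rule prob_space_exponential_density)
  show ?thesis
    unfolding waiting_def
    by (subst nn_integral_distr) (auto simp: case_prod_beta E.nn_integral_fst[symmetric])
qed

text \<open>\<open>Z\<close> is replaced by an independent copy while \<open>Y\<close> remains a
  function on the original space, so that independent variables can be integrated out one after
  another.\<close>

lemma (in prob_space) nn_integral_indep_var:
  assumes indep: "indep_var S Y T Z" and f [measurable]: "f \<in> borel_measurable (S \<Otimes>\<^sub>M T)"
  shows "(\<integral>\<^sup>+\<omega>. f (Y \<omega>, Z \<omega>) \<partial>M) = (\<integral>\<^sup>+\<omega>. \<integral>\<^sup>+z. f (Y \<omega>, z) \<partial>distr M T Z \<partial>M)"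
proof -
  have [measurable]: "Y \<in> measurable M S" "Z \<in> measurable M T"
    using indep by (auto dest: indep_var_rv1 indep_var_rv2)
  interpret Z: prob_space "distr M T Z" by (rule prob_space_distr) measurable
  have "(\<integral>\<^sup>+\<omega>. f (Y \<omega>, Z \<omega>) \<partial>M) = (\<integral>\<^sup>+p. f p \<partial>(distr M S Y \<Otimes>\<^sub>M distr M T Z))"
    using indep unfolding indep_var_distribution_eq by (simp add: nn_integral_distr)
  also have "\<dots> = (\<integral>\<^sup>+y. \<integral>\<^sup>+z. f (y, z) \<partial>distr M T Z \<partial>distr M S Y)"
    by (rule Z.nn_integral_fst[symmetric]) measurable
  also have "\<dots> = (\<integral>\<^sup>+\<omega>. \<integral>\<^sup>+z. f (Y \<omega>, z) \<partial>distr M T Z \<partial>M)"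
    by (rule nn_integral_distr) measurable
  finally show ?thesis .
qed

context unreliable_MG1
begin

definition gap_or_occupation :: "nat + nat \<Rightarrow> 'w \<Rightarrow> real" where
  "gap_or_occupation i = (case i of Inl n \<Rightarrow> X (Gap n) | Inr n \<Rightarrow> occupation X n)"

lemma measurable_gap_or_occupation [measurable]: "gap_or_occupation i \<in> borel_measurable M"
  by (auto simp: gap_or_occupation_def split: sum.split)

lemma sojourn_eq_rec: "sojourn X v n \<omega> = sojourn_rec v n (\<lambda>i. gap_or_occupation i \<omega>)"
  by (induction n) (simp_all add: sojourn_0 sojourn_Suc gap_or_occupation_def)

text \<open>Each gap is a block of its own, and requirement, lifetimes and repairs of one packet
  form another. The blocks are disjoint, and \<open>f\<close> computes each variable from the
  coordinates of its block.\<close>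

lemma indep_gap_or_occupation: "indep_vars (\<lambda>_. borel) gap_or_occupation UNIV"
proof -
  define K where "K i = (case i of Inl n \<Rightarrow> {Gap n}
    | Inr n \<Rightarrow> insert (Service n) (range (Lifetime n) \<union> range (Repair n)))" for i :: "nat + nat"
  define f where "f i = (case i of Inl n \<Rightarrow> (\<lambda>h. h (Gap n)) | Inr n \<Rightarrow> occupation (\<lambda>s h. h s) n)"
    for i :: "nat + nat"
  have "disjoint_family K"
    by (auto simp: disjoint_family_on_def K_def split: sum.splits)
  moreover have "f i \<in> borel_measurable (PiM (K i) (\<lambda>_. borel))" for i
  proof (cases i)
    case (Inl n)
    then show ?thesis by (simp add: f_def K_def)
  next
    case (Inr n)
    have "occupation (\<lambda>s h. h s) n \<in> borel_measurable (PiM (K i) (\<lambda>_. borel))"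
      by (rule borel_measurable_occupation; rule measurable_component_singleton) (auto simp: K_def Inr)
    then show ?thesis by (simp add: f_def Inr)
  qed
  ultimately have "indep_vars (\<lambda>_. borel) (\<lambda>i \<omega>. f i (restrict (\<lambda>s. X s \<omega>) (K i))) UNIV"
    by (rule indep_vars_blocks[OF independent])
  moreover have "f i (restrict (\<lambda>s. X s \<omega>) (K i)) = gap_or_occupation i \<omega>" for i \<omega>
    by (cases i) (simp_all add: f_def K_def gap_or_occupation_def occupation_def failures_def)
  ultimately show ?thesis by simp
qed

lemma measurable_sojourn [measurable]: "sojourn X v n \<in> borel_measurable M"
  by (induction n) (simp_all add: sojourn_0[abs_def] sojourn_Suc[abs_def])

lemma measurable_sojourn_pair:
  assumes [measurable_cong]: "sets \<pi> = sets borel"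
  shows "(\<lambda>(v, \<omega>). sojourn X v n \<omega>) \<in> borel_measurable (\<pi> \<Otimes>\<^sub>M M)"
  by (induction n) (simp_all add: sojourn_0 sojourn_Suc case_prod_beta)

lemma nn_integral_sojourn_Suc:
  assumes [measurable]: "f \<in> borel_measurable borel"
  shows "(\<integral>\<^sup>+\<omega>. f (sojourn X v (Suc n) \<omega>) \<partial>M)
    = (\<integral>\<^sup>+\<omega>. \<integral>\<^sup>+g. \<integral>\<^sup>+c. f (max 0 (sojourn X v n \<omega> - g) + c) \<partial>occupation_law
        \<partial>density lborel (exponential_density lam) \<partial>M)"
proof -
  let ?E = "density lborel (exponential_density lam)"
  interpret C: nonneg_distribution occupation_law by (rule nonneg_occupation_law)
  interpret E: prob_space ?E
    using arrival_rate_pos by (rule prob_space_exponential_density)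
  let ?Z = "gap_or_occupation" and ?A = "insert (Inl n) (past n)"
  define U where "U \<omega> = max 0 (sojourn X v n \<omega> - X (Gap n) \<omega>)" for \<omega>
  have [measurable]: "U \<in> borel_measurable M" unfolding U_def[abs_def] by measurable
  have "indep_var borel (\<lambda>\<omega>. sojourn_rec v n (restrict (\<lambda>i. ?Z i \<omega>) (past n)))
      borel (\<lambda>\<omega>. (\<lambda>z. z (Inl n)) (restrict (\<lambda>i. ?Z i \<omega>) {Inl n}))"
    by (rule indep_var_blocks[OF indep_gap_or_occupation])
      (auto simp: past_def[of n] intro!: borel_measurable_sojourn_rec)
  then have indep_gap: "indep_var borel (sojourn X v n) borel (X (Gap n))"
    by (simp add: sojourn_rec_restrict sojourn_eq_rec[abs_def] gap_or_occupation_def)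
  have "indep_var borel (\<lambda>\<omega>. (\<lambda>z. max 0 (sojourn_rec v n z - z (Inl n))) (restrict (\<lambda>i. ?Z i \<omega>) ?A))
      borel (\<lambda>\<omega>. (\<lambda>z. z (Inr (Suc n))) (restrict (\<lambda>i. ?Z i \<omega>) {Inr (Suc n)}))"
  proof (rule indep_var_blocks[OF indep_gap_or_occupation])
    have [measurable]: "sojourn_rec v n \<in> borel_measurable (PiM ?A (\<lambda>_. borel))"
      by (rule borel_measurable_sojourn_rec) auto
    have [measurable]: "(\<lambda>z. z (Inl n)) \<in> borel_measurable (PiM ?A (\<lambda>_. borel))"
      by measurable
    show "(\<lambda>z. max 0 (sojourn_rec v n z - z (Inl n))) \<in> borel_measurable (PiM ?A (\<lambda>_. borel))"
      by measurable
  qed (auto simp: past_def)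
  moreover have "(\<lambda>z. max 0 (sojourn_rec v n z - z (Inl n))) (restrict (\<lambda>i. ?Z i \<omega>) ?A) = U \<omega>" for \<omega>
    by (subst sojourn_rec_restrict) (auto simp: U_def sojourn_eq_rec gap_or_occupation_def)
  ultimately have indep_occ: "indep_var borel U borel (occupation X (Suc n))"
    by (simp add: gap_or_occupation_def)
  have gap: "distr M borel (X (Gap n)) = ?E"
    using distributed_distr_eq_density[OF gap_law[of n]]
    by (metis distr_cong sets_lborel)
  have "(\<integral>\<^sup>+\<omega>. f (sojourn X v (Suc n) \<omega>) \<partial>M) = (\<integral>\<^sup>+\<omega>. f (U \<omega> + occupation X (Suc n) \<omega>) \<partial>M)"
    by (simp add: U_def sojourn_Suc)
  \<comment> \<open>The new occupation time is integrated out first, being independent of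
    \<open>U\<close>; the gap inside \<open>U\<close> follows, being independent of the previous
    sojourn time.\<close>
  also have "\<dots> = (\<integral>\<^sup>+\<omega>. \<integral>\<^sup>+c. f (U \<omega> + c) \<partial>occupation_law \<partial>M)"
    using nn_integral_indep_var[OF indep_occ, of "\<lambda>(u, c). f (u + c)"]
    by (simp add: distr_occupation)
  also have "\<dots> = (\<integral>\<^sup>+\<omega>. \<integral>\<^sup>+g. \<integral>\<^sup>+c. f (max 0 (sojourn X v n \<omega> - g) + c) \<partial>occupation_law \<partial>?E \<partial>M)"
    using nn_integral_indep_var[OF indep_gap, of "\<lambda>(w, g). \<integral>\<^sup>+c. f (max 0 (w - g) + c) \<partial>occupation_law"]
    by (simp add: U_def gap)
  finally show ?thesis .
qed

lemma nn_integral_sojourn_law: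
  assumes "real_distribution \<pi>" and [measurable]: "f \<in> borel_measurable borel"
  shows "(\<integral>\<^sup>+x. f x \<partial>sojourn_law M X \<pi> n) = (\<integral>\<^sup>+v. \<integral>\<^sup>+\<omega>. f (sojourn X v n \<omega>) \<partial>M \<partial>\<pi>)"
proof -
  interpret \<pi>: real_distribution \<pi> by fact
  have [measurable]: "(\<lambda>(v, \<omega>). sojourn X v n \<omega>) \<in> borel_measurable (\<pi> \<Otimes>\<^sub>M M)"
    by (rule measurable_sojourn_pair) simp
  have "(\<integral>\<^sup>+x. f x \<partial>sojourn_law M X \<pi> n) = (\<integral>\<^sup>+z. f ((\<lambda>(v, \<omega>). sojourn X v n \<omega>) z) \<partial>(\<pi> \<Otimes>\<^sub>M M))"
    unfolding sojourn_law_def by (rule nn_integral_distr) measurable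
  also have "\<dots> = (\<integral>\<^sup>+v. \<integral>\<^sup>+\<omega>. f ((\<lambda>(v, \<omega>). sojourn X v n \<omega>) (v, \<omega>)) \<partial>M \<partial>\<pi>)"
    by (rule nn_integral_fst[symmetric]) measurable
  finally show ?thesis by (simp only: prod.case)
qed

lemma real_distribution_sojourn_law:
  assumes "real_distribution \<pi>"
  shows "real_distribution (sojourn_law M X \<pi> n)"
proof -
  interpret \<pi>: real_distribution \<pi> by fact
  interpret P: pair_prob_space \<pi> M ..
  show ?thesis
    unfolding sojourn_law_def by (rule P.real_distribution_distr) (rule measurable_sojourn_pair, simp)
qed

text \<open>Integrated against a test function, both sides unfold to the same iterated integral over
  initial backlog, history, gap and occupation time.\<close>

lemma sojourn_law_Suc:
  assumes "real_distribution \<pi>"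
  shows "sojourn_law M X \<pi> (Suc n) = (waiting lam (sojourn_law M X \<pi> n) \<star> occupation_law)"
proof (rule measure_eqI_nn_integral)
  show "sets (sojourn_law M X \<pi> (Suc n)) = sets (waiting lam (sojourn_law M X \<pi> n) \<star> occupation_law)"
    by (simp add: sojourn_law_def)
  fix f :: "real \<Rightarrow> ennreal" assume "f \<in> borel_measurable (sojourn_law M X \<pi> (Suc n))"
  then have [measurable]: "f \<in> borel_measurable borel" by (simp add: sojourn_law_def)
  let ?E = "density lborel (exponential_density lam)"
  interpret E: prob_space ?E
    using arrival_rate_pos by (rule prob_space_exponential_density)
  interpret C: nonneg_distribution occupation_law by (rule nonneg_occupation_law)
  have L: "real_distribution (sojourn_law M X \<pi> n)"
    using assms by (rule real_distribution_sojourn_law)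
  interpret W: nonneg_distribution "waiting lam (sojourn_law M X \<pi> n)"
    by (rule nonneg_distribution_waiting[OF L arrival_rate_pos])
  have [measurable_cong]: "sets occupation_law = sets borel" by simp
  have "(\<integral>\<^sup>+x. f x \<partial>(waiting lam (sojourn_law M X \<pi> n) \<star> occupation_law))
      = (\<integral>\<^sup>+w. \<integral>\<^sup>+c. f (w + c) \<partial>occupation_law \<partial>waiting lam (sojourn_law M X \<pi> n))"
    by (rule nn_integral_convolution) (simp_all add: W.finite_measure_axioms C.finite_measure_axioms)
  also have "\<dots> = (\<integral>\<^sup>+w. \<integral>\<^sup>+g. \<integral>\<^sup>+c. f (max 0 (w - g) + c) \<partial>occupation_law \<partial>?E \<partial>sojourn_law M X \<pi> n)"
    by (rule nn_integral_waiting[OF L arrival_rate_pos]) measurable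
  also have "\<dots> = (\<integral>\<^sup>+v. \<integral>\<^sup>+\<omega>. \<integral>\<^sup>+g. \<integral>\<^sup>+c. f (max 0 (sojourn X v n \<omega> - g) + c) \<partial>occupation_law \<partial>?E \<partial>M \<partial>\<pi>)"
    by (rule nn_integral_sojourn_law[OF assms]) measurable
  also have "\<dots> = (\<integral>\<^sup>+v. \<integral>\<^sup>+\<omega>. f (sojourn X v (Suc n) \<omega>) \<partial>M \<partial>\<pi>)"
    by (simp only: nn_integral_sojourn_Suc[OF \<open>f \<in> borel_measurable borel\<close>])
  also have "\<dots> = (\<integral>\<^sup>+x. f x \<partial>sojourn_law M X \<pi> (Suc n))"
    by (rule nn_integral_sojourn_law[OF assms, symmetric]) measurable
  finally show "(\<integral>\<^sup>+x. f x \<partial>sojourn_law M X \<pi> (Suc n))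
      = (\<integral>\<^sup>+x. f x \<partial>(waiting lam (sojourn_law M X \<pi> n) \<star> occupation_law))" ..
qed

lemma sojourn_law_0:
  assumes "nonneg_distribution \<pi>"
  shows "sojourn_law M X \<pi> 0 = (\<pi> \<star> occupation_law)"
proof (rule measure_eqI_nn_integral)
  interpret \<pi>: nonneg_distribution \<pi> by fact
  interpret C: nonneg_distribution occupation_law by (rule nonneg_occupation_law)
  show "sets (sojourn_law M X \<pi> 0) = sets (\<pi> \<star> occupation_law)"
    by (simp add: sojourn_law_def)
  fix f :: "real \<Rightarrow> ennreal" assume "f \<in> borel_measurable (sojourn_law M X \<pi> 0)"
  then have [measurable]: "f \<in> borel_measurable borel" by (simp add: sojourn_law_def)
  have "(\<integral>\<^sup>+x. f x \<partial>sojourn_law M X \<pi> 0) = (\<integral>\<^sup>+v. \<integral>\<^sup>+\<omega>. f (max 0 v + occupation X 0 \<omega>) \<partial>M \<partial>\<pi>)"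
    unfolding nn_integral_sojourn_law[OF \<pi>.real_distribution_axioms \<open>f \<in> borel_measurable borel\<close>] sojourn_0 ..
  also have "\<dots> = (\<integral>\<^sup>+v. \<integral>\<^sup>+\<omega>. f (v + occupation X 0 \<omega>) \<partial>M \<partial>\<pi>)"
    using \<pi>.AE_nonneg by (intro nn_integral_cong_AE) (auto simp: max_def)
  also have "\<dots> = (\<integral>\<^sup>+v. \<integral>\<^sup>+c. f (v + c) \<partial>occupation_law \<partial>\<pi>)"
    unfolding occupation_law_def by (subst nn_integral_distr) simp_all
  also have "\<dots> = (\<integral>\<^sup>+x. f x \<partial>(\<pi> \<star> occupation_law))"
    by (rule nn_integral_convolution[symmetric]) (simp_all add: \<pi>.finite_measure_axioms C.finite_measure_axioms)
  finally show "(\<integral>\<^sup>+x. f x \<partial>sojourn_law M X \<pi> 0) = (\<integral>\<^sup>+x. f x \<partial>(\<pi> \<star> occupation_law))" .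
qed

end

text \<open>Existence of a steady state is part of the claim, so that the formula is not vacuously
  true.\<close>

theorem mainTheorem2:
  fixes M :: "'w measure"
    and lam \<alpha> \<beta> \<gamma> p\<^sub>0 :: real
    and F\<^sub>S F\<^sub>R :: "real measure"
    and X :: "source \<Rightarrow> 'w \<Rightarrow> real"
  assumes "unreliable_MG1 M lam \<alpha> F\<^sub>S F\<^sub>R X"
    and "\<beta> = mean F\<^sub>S"
    and "\<gamma> = mean F\<^sub>R"
    and "lam * \<beta> * (1 + \<alpha> * \<gamma>) < 1"
    and "p\<^sub>0 = 1 - lam * \<beta> * (1 + \<alpha> * \<gamma>)"
  shows "(\<exists>\<pi>. steady_state M X \<pi>) \<and>
    (\<forall>\<pi>. steady_state M X \<pi> \<longrightarrow>
      (\<forall>n. \<forall>a>0. LST (sojourn_law M X \<pi> n) a =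
        a * LST F\<^sub>S (a + \<alpha> * (1 - LST F\<^sub>R a)) * p\<^sub>0 /
          (a - lam * (1 - LST F\<^sub>S (a + \<alpha> * (1 - LST F\<^sub>R a))))))"
proof -
  interpret unreliable_MG1 M lam \<alpha> F\<^sub>S F\<^sub>R X by fact
  have int: "integrable occupation_law (\<lambda>t. t)"
    by (rule mean_occupation_law)
  have p0: "1 - lam * mean occupation_law = p\<^sub>0" and stable: "lam * mean occupation_law < 1"
    using assms by (simp_all add: mean_occupation_law mult.assoc)
  show ?thesis
  proof (intro conjI allI impI)
    obtain \<pi> where \<pi>: "nonneg_distribution \<pi>"
      and fixed: "(waiting lam (\<pi> \<star> occupation_law) \<star> occupation_law) = (\<pi> \<star> occupation_law)"
      using exists_lindley_fixed_point[OF nonneg_occupation_law int arrival_rate_pos stable] by blast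
    interpret \<pi>: nonneg_distribution \<pi> by (rule \<pi>)
    \<comment> \<open>Packet 0 already has the fixed-point law, and each Lindley step preserves
      it.\<close>
    have "sojourn_law M X \<pi> n = (\<pi> \<star> occupation_law)" for n
      by (induction n)
        (simp_all add: sojourn_law_0[OF \<pi>] sojourn_law_Suc[OF \<pi>.real_distribution_axioms] fixed)
    then have "steady_state M X \<pi>"
      using \<pi>.AE_nonneg \<pi>.real_distribution_axioms unfolding steady_state_def by simp
    then show "\<exists>\<pi>. steady_state M X \<pi>" ..
  next
    fix \<pi> n and a :: real
    assume ss: "steady_state M X \<pi>" and a: "0 < a"
    have \<pi>: "nonneg_distribution \<pi>"
      using ss unfolding steady_state_def nonneg_distribution_def nonneg_distribution_axioms_def by blast
    have \<pi>_real: "real_distribution \<pi>" using \<pi> by (rule nonneg_distribution.axioms)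
    let ?\<mu> = "sojourn_law M X \<pi> 0"
    have "nonneg_distribution ?\<mu>"
      unfolding sojourn_law_0[OF \<pi>] by (rule nonneg_distribution_convolution[OF \<pi> nonneg_occupation_law])
    \<comment> \<open>Equality of the laws of packets 1 and 0 is exactly the fixed-point
      equation.\<close>
    moreover have "(waiting lam ?\<mu> \<star> occupation_law) = ?\<mu>"
      using ss sojourn_law_Suc[OF \<pi>_real, of 0] unfolding steady_state_def by metis
    ultimately have "LST ?\<mu> a = a * LST occupation_law a * p\<^sub>0 / (a - lam * (1 - LST occupation_law a))"
      using LST_lindley_fixed_point[OF _ nonneg_occupation_law int arrival_rate_pos stable _ a]
      unfolding p0 by blast
    moreover have "sojourn_law M X \<pi> n = ?\<mu>"
      using ss unfolding steady_state_def by blast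
    ultimately show "LST (sojourn_law M X \<pi> n) a =
        a * LST F\<^sub>S (a + \<alpha> * (1 - LST F\<^sub>R a)) * p\<^sub>0 /
          (a - lam * (1 - LST F\<^sub>S (a + \<alpha> * (1 - LST F\<^sub>R a))))"
      using LST_occupation_law[of a] a by simp
  qed
qed

end
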